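(* Let $\Sigma=(\Gamma,\sigma)$ be a signed graph with underlying graph $\Gamma=(V,E)$ and $G$ a finite additive abelian group. The number of $G$-tensions of $\Sigma$ is $t^0_\Sigma(G)=|G|^{|V|-k_b(\Sigma)}$, and the number of $G$-potential differences of $\Sigma$ is $p^0_\Sigma(G)=|G|^{|V|-k(\Sigma)}|2G|^{k_u(\Sigma)}$.
   Context: A signed graph $\Sigma=(\Gamma,\sigma)$: finite graph $\Gamma=(V,E)$ (loops, multiple edges allowed), $\sigma:E\to\{-1,1\}$. A cycle (loops included) is balanced if the product of its edge signs is $1$, unbalanced otherwise. $k,k_b,k_u$: numbers of connected components, balanced components (all cycles balanced), unbalanced components. Each edge $e$ with endpoints $u,v$ has half-edges $(u,e),(v,e)$; an orientation $\omega$ assigns $\pm1$ to each half-edge, compatible with $\sigma$ if $\sigma(e)=-\omega(u,e)\omega(v,e)$; fix one (counts do not depend on it). A walk $(v_1,e_1,\dots,v_k,e_k,v_{k+1})$ has $e_i$ joining $v_i,v_{i+1}$; $\omega(v_i,e_i)$ is the orientation of the half-edge of $e_i$ at $v_i$ by which the walk leaves $v_i$. Circuits of $\Sigma$: edge sets of balanced cycles, of unbalanced tight handcuffs (two unbalanced cycles sharing exactly one vertex) and of unbalanced loose handcuffs (two vertex-disjoint unbalanced cycles joined by a path meeting them only at its endpoints, whose edges are circuit path edges). A circuit walk is a closed walk traversing a circuit using circuit path edges twice and other edges once. $f:E\to G$ is a $G$-tension if for every circuit walk $(v_1,e_1,\dots,v_k,e_k,v_1)$, $\sum_{i=1}^k\big(\omega(v_i,e_i)\prod_{j<i}\sigma(e_j)\big)f(e_i)=0$;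 a $G$-potential difference if additionally $\sum_if(e_i)\in2G=\{x+x:x\in G\}$ for every closed walk around an unbalanced cycle. Zero values are allowed. *)

theory Defs
  imports Main "HOL-Library.FuncSet" "HOL-Library.Cardinality"
begin

text \<open>
  The two half-edges of an edge \<open>e\<close> are \<open>(e, True)\<close> and \<open>(e, False)\<close>; the naming of the two
  ends is arbitrary. Indexing by a Boolean instead of by the incident vertex keeps the two
  half-edges of a loop apart. The function \<open>endpoint\<close> gives the vertex at which a half-edge sits.
\<close>

record ('v, 'e) sgraph =
  verts :: "'v set"
  edges :: "'e set"
  endpoint :: "'e \<times> bool \<Rightarrow> 'v"
  esign :: "'e \<Rightarrow> int"

definition signed_graph :: "('v, 'e) sgraph \<Rightarrow> bool" where
  "signed_graph S \<longleftrightarrow>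
     finite (verts S) \<and> finite (edges S) \<and>
     (\<forall>e\<in>edges S. \<forall>b. endpoint S (e, b) \<in> verts S) \<and>
     (\<forall>e\<in>edges S. esign S e \<in> {-1, 1})"

definition compatible_orientation :: "('v, 'e) sgraph \<Rightarrow> ('e \<times> bool \<Rightarrow> int) \<Rightarrow> bool" where
  "compatible_orientation S \<omega> \<longleftrightarrow>
     (\<forall>e\<in>edges S. (\<forall>b. \<omega> (e, b) \<in> {-1, 1}) \<and>
        esign S e = - (\<omega> (e, True) * \<omega> (e, False)))"

text \<open>
  A walk is given by its initial vertex and the list of half-edges by which it leaves
  its successive vertices.
\<close>

definition leaves :: "('v, 'e) sgraph \<Rightarrow> 'e \<times> bool \<Rightarrow> 'v" where
  "leaves S h = endpoint S h"

definition arrives :: "('v, 'e) sgraph \<Rightarrow> 'e \<times> bool \<Rightarrow> 'v" where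
  "arrives S h = endpoint S (fst h, \<not> snd h)"

fun walk :: "('v, 'e) sgraph \<Rightarrow> 'v \<Rightarrow> ('e \<times> bool) list \<Rightarrow> 'v \<Rightarrow> bool" where
  "walk S u [] v \<longleftrightarrow> u \<in> verts S \<and> u = v"
| "walk S u (h # hs) v \<longleftrightarrow> fst h \<in> edges S \<and> leaves S h = u \<and> walk S (arrives S h) hs v"

definition closed_walk :: "('v, 'e) sgraph \<Rightarrow> ('e \<times> bool) list \<Rightarrow> bool" where
  "closed_walk S hs \<longleftrightarrow> hs \<noteq> [] \<and> walk S (leaves S (hd hs)) hs (leaves S (hd hs))"

definition edges_of :: "('e \<times> bool) list \<Rightarrow> 'e set" where
  "edges_of hs = fst ` set hs"

text \<open>
  Loops are the cycles of length 1; distinctness of the edges excludes going back and forth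
  along a single edge.
\<close>

definition cycle_walk :: "('v, 'e) sgraph \<Rightarrow> ('e \<times> bool) list \<Rightarrow> bool" where
  "cycle_walk S hs \<longleftrightarrow>
     closed_walk S hs \<and> distinct (map (leaves S) hs) \<and> distinct (map fst hs)"

definition cycle :: "('v, 'e) sgraph \<Rightarrow> 'e set \<Rightarrow> bool" where
  "cycle S C \<longleftrightarrow> (\<exists>hs. cycle_walk S hs \<and> edges_of hs = C)"

definition balanced_cycle :: "('v, 'e) sgraph \<Rightarrow> 'e set \<Rightarrow> bool" where
  "balanced_cycle S C \<longleftrightarrow> cycle S C \<and> (\<Prod>e\<in>C. esign S e) = 1"

definition unbalanced_cycle :: "('v, 'e) sgraph \<Rightarrow> 'e set \<Rightarrow> bool" where
  "unbalanced_cycle S C \<longleftrightarrow> cycle S C \<and> (\<Prod>e\<in>C. esign S e) \<noteq> 1"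

definition edge_verts :: "('v, 'e) sgraph \<Rightarrow> 'e set \<Rightarrow> 'v set" where
  "edge_verts S C = endpoint S ` (C \<times> UNIV)"

definition components :: "('v, 'e) sgraph \<Rightarrow> 'v set set" where
  "components S = verts S // {(u, v). u \<in> verts S \<and> v \<in> verts S \<and> (\<exists>hs. walk S u hs v)}"

definition balanced_component :: "('v, 'e) sgraph \<Rightarrow> 'v set \<Rightarrow> bool" where
  "balanced_component S X \<longleftrightarrow> X \<in> components S \<and>
     (\<forall>C. cycle S C \<and> edge_verts S C \<subseteq> X \<longrightarrow> balanced_cycle S C)"

definition num_components :: "('v, 'e) sgraph \<Rightarrow> nat" where
  "num_components S = card (components S)"

definition num_balanced :: "('v, 'e) sgraph \<Rightarrow> nat" where
  "num_balanced S = card {X \<in> components S. balanced_component S X}"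

definition num_unbalanced :: "('v, 'e) sgraph \<Rightarrow> nat" where
  "num_unbalanced S = card {X \<in> components S. \<not> balanced_component S X}"

definition path :: "('v, 'e) sgraph \<Rightarrow> 'v \<Rightarrow> ('e \<times> bool) list \<Rightarrow> 'v \<Rightarrow> bool" where
  "path S u hs v \<longleftrightarrow> walk S u hs v \<and> distinct (u # map (arrives S) hs)"

text \<open>
  \<open>circuit S C P\<close>: \<open>C\<close> is a circuit and \<open>P \<subseteq> C\<close> is its set of circuit path edges.
  In a tight handcuff \<open>C1 \<noteq> C2\<close> is needed because a loop shares exactly one vertex with itself.
\<close>

inductive circuit :: "('v, 'e) sgraph \<Rightarrow> 'e set \<Rightarrow> 'e set \<Rightarrow> bool" for S where
  balanced: "balanced_cycle S C \<Longrightarrow> circuit S C {}"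
| tight_handcuff:
    "unbalanced_cycle S C1 \<Longrightarrow> unbalanced_cycle S C2 \<Longrightarrow> C1 \<noteq> C2 \<Longrightarrow>
     edge_verts S C1 \<inter> edge_verts S C2 = {v} \<Longrightarrow> circuit S (C1 \<union> C2) {}"
| loose_handcuff:
    "unbalanced_cycle S C1 \<Longrightarrow> unbalanced_cycle S C2 \<Longrightarrow>
     edge_verts S C1 \<inter> edge_verts S C2 = {} \<Longrightarrow> path S u hs w \<Longrightarrow>
     set (u # map (arrives S) hs) \<inter> edge_verts S C1 = {u} \<Longrightarrow>
     set (u # map (arrives S) hs) \<inter> edge_verts S C2 = {w} \<Longrightarrow>
     circuit S (C1 \<union> C2 \<union> edges_of hs) (edges_of hs)"

definition circuit_walk :: "('v, 'e) sgraph \<Rightarrow> ('e \<times> bool) list \<Rightarrow> bool" where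
  "circuit_walk S hs \<longleftrightarrow> closed_walk S hs \<and>
     (\<exists>C P. circuit S C P \<and> edges_of hs = C \<and>
        (\<forall>e\<in>C. count_list (map fst hs) e = (if e \<in> P then 2 else 1)))"

text \<open>The action of a sign \<open>s \<in> {-1, 1}\<close> on an abelian group.\<close>

definition sign_act :: "int \<Rightarrow> 'g::ab_group_add \<Rightarrow> 'g" where
  "sign_act s x = (if s = 1 then x else - x)"

definition tension ::
    "('v, 'e) sgraph \<Rightarrow> ('e \<times> bool \<Rightarrow> int) \<Rightarrow> ('e \<Rightarrow> 'g::ab_group_add) \<Rightarrow> bool" where
  "tension S \<omega> f \<longleftrightarrow> (\<forall>hs. circuit_walk S hs \<longrightarrow>
     (\<Sum>i<length hs. sign_act (\<omega> (hs ! i) * (\<Prod>j<i. esign S (fst (hs ! j)))) (f (fst (hs ! i)))) = 0)"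

definition doubles :: "'g::ab_group_add set" where
  "doubles = {x + x | x. True}"

definition potential_difference ::
    "('v, 'e) sgraph \<Rightarrow> ('e \<times> bool \<Rightarrow> int) \<Rightarrow> ('e \<Rightarrow> 'g::ab_group_add) \<Rightarrow> bool" where
  "potential_difference S \<omega> f \<longleftrightarrow> tension S \<omega> f \<and>
     (\<forall>hs. cycle_walk S hs \<and> unbalanced_cycle S (edges_of hs) \<longrightarrow>
        (\<Sum>i<length hs. f (fst (hs ! i))) \<in> doubles)"

text \<open>
  Functions on the edge set are taken extensional, so that each map \<open>E \<rightarrow> G\<close> is counted once.
\<close>

definition tensions ::
    "('v, 'e) sgraph \<Rightarrow> ('e \<times> bool \<Rightarrow> int) \<Rightarrow> ('e \<Rightarrow> 'g::ab_group_add) set" where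
  "tensions S \<omega> = {f \<in> edges S \<rightarrow>\<^sub>E UNIV. tension S \<omega> f}"

definition potential_differences ::
    "('v, 'e) sgraph \<Rightarrow> ('e \<times> bool \<Rightarrow> int) \<Rightarrow> ('e \<Rightarrow> 'g::ab_group_add) set" where
  "potential_differences S \<omega> = {f \<in> edges S \<rightarrow>\<^sub>E UNIV. potential_difference S \<omega> f}"

end

theory Submission
  imports Defs "HOL-Library.Multiset"
begin

text \<open>
  The signed sum in the definition of a tension and the sign of a walk together form its holonomy,
  an element of the generalised dihedral group of \<open>G\<close>. Holonomy is multiplicative, and the holonomy
  of a negative walk is an involution. A function is a tension iff it is flat: every closed walk
  that is not negative has trivial holonomy. To see this, take a shortest closed walk violating
  flatness. Cutting it at a repeated vertex gives two negative closed walks. Hence it visits no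
  vertex three times, and no two repetitions cross, as it would then be the square of a negative
  closed walk up to holonomy. So it is a balanced cycle, goes back and forth along an edge, or has
  the form \<open>B P D Q\<close> with negative cycles \<open>B\<close> and \<open>D\<close>; in the last case, replacing the longer one of
  \<open>P\<close>, \<open>Q\<close> by the reverse of the other makes it a circuit walk around a handcuff.

  Hence, with a root in each component and a walk from the root to each vertex, a tension is
  determined by the holonomies of these walks and, for each unbalanced component, by the common
  holonomy of the negative closed walks at its root; all these values can be prescribed freely.
  Signs disappear modulo \<open>2G\<close>, so a tension is a potential difference iff the negative closed walks
  have their displacements in \<open>2G\<close>.
\<close>

section \<open>The generalised dihedral group\<close>

text \<open>
  The semidirect product \<open>G \<rtimes> {1, -1}\<close>, written additively although it does not commute.
  Its elements are the maps \<open>x \<mapsto> d + x\<close> and \<open>x \<mapsto> d - x\<close>, the latter called reflecting.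
\<close>

datatype 'g dihedral = Dihedral (displacement: 'g) (reflecting: bool)

instantiation dihedral :: (ab_group_add) group_add
begin

definition "0 = Dihedral 0 False"

definition "a + b =
  Dihedral (displacement a + (if reflecting a then - displacement b else displacement b))
    (reflecting a \<noteq> reflecting b)"

definition "- a = Dihedral (if reflecting a then displacement a else - displacement a) (reflecting a)"

definition "a - b = a + - (b :: 'a dihedral)"

instance
  by standard
    (auto simp: zero_dihedral_def plus_dihedral_def uminus_dihedral_def minus_dihedral_def
      intro: dihedral.expand)

end

lemma displacement_simps [simp]:
  "displacement 0 = 0"
  "displacement (a + b) =
    displacement a + (if reflecting a then - displacement b else displacement b)"
  "displacement (- a) = (if reflecting a then displacement a else - displacement a)"
  by (simp_all add: zero_dihedral_def plus_dihedral_def uminus_dihedral_def)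

lemma reflecting_simps [simp]:
  "\<not> reflecting 0"
  "reflecting (a + b) \<longleftrightarrow> reflecting a \<noteq> reflecting b"
  "reflecting (- a) \<longleftrightarrow> reflecting a"
  by (simp_all add: zero_dihedral_def plus_dihedral_def uminus_dihedral_def)

lemma uminus_reflecting: "reflecting a \<Longrightarrow> - a = a"
  by (simp add: dihedral.expand)

lemma reflecting_add_self: "reflecting a \<Longrightarrow> a + a = 0"
  by (simp add: dihedral.expand)

section \<open>Doubles\<close>

lemma double_in_doubles: "x + x \<in> doubles"
  by (auto simp: doubles_def)

lemma zero_in_doubles: "(0 :: 'g::ab_group_add) \<in> doubles"
  using double_in_doubles[of "0 :: 'g"] by simp

lemma uminus_diff_self_in_doubles: "- x - x \<in> doubles"
  using double_in_doubles[of "- x"] by simp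

lemma doubles_add:
  assumes "x \<in> doubles" "y \<in> doubles"
  shows "x + y \<in> doubles"
proof -
  obtain a b where "x = a + a" "y = b + b"
    using assms by (auto simp: doubles_def)
  then have "x + y = (a + b) + (a + b)"
    by (simp add: algebra_simps)
  then show ?thesis
    by (auto simp: doubles_def)
qed

lemma uminus_in_doubles_iff: "- x \<in> doubles \<longleftrightarrow> x \<in> doubles"
proof -
  have "- y \<in> doubles" if "y \<in> doubles" for y :: 'a
    using that by (auto simp: doubles_def intro: minus_add_distrib)
  from this[of x] this[of "- x"] show ?thesis
    by auto
qed

lemma add_in_doubles_iff:
  assumes "x \<in> doubles"
  shows "x + y \<in> doubles \<longleftrightarrow> y \<in> doubles"
  using doubles_add[OF assms, of y] doubles_add[of "- x" "x + y"] assms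
  by (auto simp: uminus_in_doubles_iff)

lemma displacement_conjugate_in_doubles_iff:
  assumes "reflecting b"
  shows "displacement (a + b - a) \<in> doubles \<longleftrightarrow> displacement b \<in> doubles"
proof -
  have "displacement (a + b - a) = (displacement a + displacement a) +
    (if reflecting a then - displacement b else displacement b)"
    using assms by (simp add: diff_conv_add_uminus algebra_simps del: add_uminus_conv_diff)
  then show ?thesis
    by (simp add: add_in_doubles_iff[OF double_in_doubles] uminus_in_doubles_iff)
qed

section \<open>Walks\<close>

definition flip :: "'e \<times> bool \<Rightarrow> 'e \<times> bool" where
  "flip h = (fst h, \<not> snd h)"

definition reverse_walk :: "('e \<times> bool) list \<Rightarrow> ('e \<times> bool) list" where
  "reverse_walk hs = rev (map flip hs)"

abbreviation visited :: "('v, 'e) sgraph \<Rightarrow> 'v \<Rightarrow> ('e \<times> bool) list \<Rightarrow> 'v set" where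
  "visited S u hs \<equiv> set (u # map (arrives S) hs)"

lemma flip_simps [simp]:
  "fst (flip h) = fst h" "leaves S (flip h) = arrives S h" "arrives S (flip h) = leaves S h"
  "flip (flip h) = h"
  by (simp_all add: flip_def leaves_def arrives_def)

lemma fst_eq_iff_flip: "fst h = fst k \<longleftrightarrow> k = h \<or> k = flip h"
  by (cases h; cases k) (auto simp: flip_def)

lemma reverse_walk_simps [simp]:
  "reverse_walk [] = []" "reverse_walk (h # hs) = reverse_walk hs @ [flip h]"
  "reverse_walk (hs @ ks) = reverse_walk ks @ reverse_walk hs"
  "reverse_walk (reverse_walk hs) = hs"
  "reverse_walk hs = [] \<longleftrightarrow> hs = []"
  "length (reverse_walk hs) = length hs"
  by (simp_all add: reverse_walk_def rev_map comp_def)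

lemma map_fst_reverse_walk [simp]: "map fst (reverse_walk hs) = rev (map fst hs)"
  by (simp add: reverse_walk_def rev_map comp_def)

lemma edges_of_simps [simp]:
  "edges_of [] = {}" "edges_of (h # hs) = insert (fst h) (edges_of hs)"
  "edges_of (hs @ ks) = edges_of hs \<union> edges_of ks"
  "edges_of (reverse_walk hs) = edges_of hs"
  by (auto simp: edges_of_def reverse_walk_def image_image)

lemma finite_edges_of: "finite (edges_of hs)"
  by (simp add: edges_of_def)

lemma prod_list_edges:
  fixes g :: "'e \<Rightarrow> 'a::comm_monoid_mult"
  shows "(\<Prod>h\<leftarrow>hs. g (fst h)) = (\<Prod>e\<in>edges_of hs. g e ^ count_list (map fst hs) e)"
  using image_prod_mset_multiplicity[of g "mset (map fst hs)"]
  by (simp add: edges_of_def image_mset.compositionality comp_def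
      flip: prod_mset_prod_list count_mset)

lemma count_list_distinct_edges:
  "distinct (map fst hs) \<Longrightarrow> count_list (map fst hs) e = (if e \<in> edges_of hs then 1 else 0)"
  using distinct_count_atmost_1[of "map fst hs"] by (simp add: edges_of_def flip: count_mset)

lemma edge_verts_edges_of:
  fixes S :: "('v, 'e) sgraph"
  shows "edge_verts S (edges_of hs) = leaves S ` set hs \<union> arrives S ` set hs"
proof -
  have "endpoint S ` ({fst h} \<times> UNIV) = {leaves S h, arrives S h}" for h :: "'e \<times> bool"
    by (cases h; cases "snd h") (auto simp: leaves_def arrives_def UNIV_bool)
  moreover have "edge_verts S (edges_of hs) = (\<Union>h\<in>set hs. endpoint S ` ({fst h} \<times> UNIV))"
    by (auto simp: edge_verts_def edges_of_def)
  ultimately show ?thesis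
    by auto
qed

lemma endpoints_in_edge_verts:
  assumes "fst h \<in> C"
  shows "leaves S h \<in> edge_verts S C" "arrives S h \<in> edge_verts S C"
  using assms by (cases h; force simp: edge_verts_def leaves_def arrives_def)+

lemma closed_walk_iff: "closed_walk S hs \<longleftrightarrow> hs \<noteq> [] \<and> (\<exists>v. walk S v hs v)"
  by (cases hs) (auto simp: closed_walk_def)

lemma walk_leaves_arrives:
  "walk S u hs v \<Longrightarrow> map (leaves S) hs @ [v] = u # map (arrives S) hs"
  by (induction hs arbitrary: u) auto

lemma walk_start_leaves: "walk S u hs v \<Longrightarrow> hs \<noteq> [] \<Longrightarrow> u \<in> leaves S ` set hs"
  by (cases hs) auto

lemma walk_end_arrives: "walk S u hs v \<Longrightarrow> hs \<noteq> [] \<Longrightarrow> v \<in> arrives S ` set hs"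
  using arg_cong[OF walk_leaves_arrives, of S u hs v last] by (auto simp: last_map)

lemma visited_eq_leaves: "walk S u hs v \<Longrightarrow> visited S u hs = insert v (leaves S ` set hs)"
  using arg_cong[OF walk_leaves_arrives, of S u hs v set] by simp

lemma visited_closed_walk: "walk S v hs v \<Longrightarrow> hs \<noteq> [] \<Longrightarrow> visited S v hs = leaves S ` set hs"
  using visited_eq_leaves walk_start_leaves by fastforce

lemma visited_reverse_walk:
  assumes "walk S u hs v"
  shows "visited S v (reverse_walk hs) = visited S u hs"
  unfolding visited_eq_leaves[OF assms] by (auto simp: reverse_walk_def image_image)

lemma edge_verts_walk:
  assumes "walk S u hs v" "hs \<noteq> []"
  shows "edge_verts S (edges_of hs) = visited S u hs"
  using walk_start_leaves[OF assms] visited_eq_leaves[OF assms(1)]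
  by (auto simp: edge_verts_edges_of)

lemma walk_edges: "walk S u hs v \<Longrightarrow> edges_of hs \<subseteq> edges S"
  by (induction hs arbitrary: u) auto

lemma path_no_loop:
  assumes "path S u hs v" "h \<in> set hs"
  shows "leaves S h \<noteq> arrives S h"
proof -
  let ?vs = "u # map (arrives S) hs"
  obtain i where i: "i < length hs" "hs ! i = h"
    using assms(2) by (auto simp: in_set_conv_nth)
  have "map (leaves S) hs @ [v] = ?vs"
    using assms(1) unfolding path_def by (intro walk_leaves_arrives) simp
  then have "leaves S h = ?vs ! i"
    using i by (metis length_map nth_append_left nth_map)
  moreover have "arrives S h = ?vs ! Suc i"
    using i by simp
  ultimately show ?thesis
    using assms(1) i nth_eq_iff_index_eq[of ?vs i "Suc i"] by (simp add: path_def)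
qed

lemma path_distinct_edges: "path S u hs v \<Longrightarrow> distinct (map fst hs)"
proof (induction hs arbitrary: u)
  case (Cons h hs)
  have "fst k \<noteq> fst h" if "k \<in> set hs" for k
  proof
    assume "fst k = fst h"
    then have "arrives S k \<in> {u, arrives S h}"
      using Cons.prems by (auto simp: fst_eq_iff_flip path_def)
    then show False
      using imageI[OF that, of "arrives S"] Cons.prems by (auto simp: path_def)
  qed
  then show ?case
    using Cons by (fastforce simp: path_def)
qed simp

lemma path_disjoint_edges:
  assumes "path S u hs v" "visited S u hs \<inter> edge_verts S C = {z}"
  shows "edges_of hs \<inter> C = {}"
proof -
  have False if "h \<in> set hs" "fst h \<in> C" for h
  proof -
    have "visited S u hs = insert v (leaves S ` set hs)"
      using assms(1) visited_eq_leaves unfolding path_def by metis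
    then have "leaves S h \<in> visited S u hs" "arrives S h \<in> visited S u hs"
      using that by auto
    then have "leaves S h = z" "arrives S h = z"
      using endpoints_in_edge_verts[OF that(2), of S] assms(2) by blast+
    then show False
      using path_no_loop[OF assms(1) that(1)] by simp
  qed
  then show ?thesis
    by (auto simp: edges_of_def)
qed

locale finite_signed_graph =
  fixes S :: "('v, 'e) sgraph"
  assumes signed_graph: "signed_graph S"
begin

lemma esign_cases: "e \<in> edges S \<Longrightarrow> esign S e \<in> {-1, 1}"
  using signed_graph by (auto simp: signed_graph_def)

lemma finite_verts: "finite (verts S)"
  using signed_graph by (simp add: signed_graph_def)

lemma arrives_in_verts: "fst h \<in> edges S \<Longrightarrow> arrives S h \<in> verts S"
  and leaves_in_verts: "fst h \<in> edges S \<Longrightarrow> leaves S h \<in> verts S"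
  using signed_graph by (cases h; auto simp: signed_graph_def arrives_def leaves_def)+

lemma walk_in_verts: "walk S u hs v \<Longrightarrow> u \<in> verts S \<and> v \<in> verts S"
  by (induction hs arbitrary: u) (auto simp: leaves_in_verts)

lemma walk_append: "walk S u (hs @ ks) v \<longleftrightarrow> (\<exists>w. walk S u hs w \<and> walk S w ks v)"
  by (induction hs arbitrary: u) (auto dest: walk_in_verts)

lemma walk_appendI [intro]: "walk S u hs w \<Longrightarrow> walk S w ks v \<Longrightarrow> walk S u (hs @ ks) v"
  by (auto simp: walk_append)

lemma walk_reverse [intro]: "walk S u hs v \<Longrightarrow> walk S v (reverse_walk hs) u"
  by (induction hs arbitrary: u) (auto simp: walk_append leaves_in_verts)

lemma walk_split:
  assumes "walk S u hs v" "z \<in> visited S u hs"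
  obtains A B where "hs = A @ B" "walk S u A z" "walk S z B v"
proof (cases "z = u")
  case True
  then show thesis
    using that[of "[]" hs] assms walk_in_verts by auto
next
  case False
  then obtain A h B where "hs = A @ h # B" "z = arrives S h"
    using assms(2) by (auto dest: split_list)
  then show thesis
    using that[of "A @ [h]" B] assms(1) by (auto simp: walk_append dest: walk_in_verts)
qed

definition negative :: "('e \<times> bool) list \<Rightarrow> bool" where
  "negative hs \<longleftrightarrow> odd (length (filter (\<lambda>h. esign S (fst h) \<noteq> 1) hs))"

lemma negative_simps [simp]:
  "\<not> negative []"
  "negative (h # hs) \<longleftrightarrow> (esign S (fst h) \<noteq> 1) \<noteq> negative hs"
  "negative (hs @ ks) \<longleftrightarrow> negative hs \<noteq> negative ks"
  "negative (reverse_walk hs) \<longleftrightarrow> negative hs"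
  by (auto simp: negative_def reverse_walk_def filter_map comp_def simp flip: rev_filter)

lemma prod_list_esign:
  "edges_of hs \<subseteq> edges S \<Longrightarrow> (\<Prod>h\<leftarrow>hs. esign S (fst h)) = (if negative hs then -1 else 1)"
  by (induction hs) (use esign_cases in force)+

section \<open>Simple closed walks and cycles\<close>

definition simple_closed_walk :: "'v \<Rightarrow> ('e \<times> bool) list \<Rightarrow> bool" where
  "simple_closed_walk v hs \<longleftrightarrow> walk S v hs v \<and> hs \<noteq> [] \<and> distinct (map (leaves S) hs)"

lemma simple_closed_walk_rotate:
  assumes "simple_closed_walk u (A @ B)"
  obtains v where "simple_closed_walk v (B @ A)"
  using assms by (auto simp: simple_closed_walk_def walk_append)

lemma path_or_simple_closed_subwalk:
  assumes "walk S u hs v"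
  shows "path S u hs v \<or>
    (\<exists>A B C z. hs = A @ B @ C \<and> walk S u A z \<and> simple_closed_walk z B \<and> walk S z C v)"
  using assms
proof (induction hs arbitrary: u)
  case (Cons h hs)
  let ?w = "arrives S h"
  have hs: "walk S ?w hs v"
    using Cons.prems by simp
  from Cons.IH[OF hs] consider (path) "path S ?w hs v"
    | (subwalk) A B C z where "hs = A @ B @ C" "walk S ?w A z" "simple_closed_walk z B" "walk S z C v"
    by blast
  then show ?case
  proof cases
    case path
    show ?thesis
    proof (cases "u \<in> visited S ?w hs")
      case True
      then obtain A B where AB: "hs = A @ B" "walk S ?w A u" "walk S u B v"
        using walk_split[OF hs] by metis
      have "distinct (map (leaves S) A @ [u])"
        unfolding walk_leaves_arrives[OF AB(2)] using path AB(1) by (simp add: path_def)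
      then have "simple_closed_walk u (h # A)"
        using Cons.prems AB(2) by (auto simp: simple_closed_walk_def)
      then show ?thesis
        using AB walk_in_verts[OF Cons.prems]
        by (intro disjI2 exI[of _ "[]"] exI[of _ "h # A"] exI[of _ B] exI[of _ u]) simp
    next
      case False
      then show ?thesis
        using path Cons.prems by (simp add: path_def)
    qed
  next
    case subwalk
    then show ?thesis
      using Cons.prems by (intro disjI2 exI[of _ "h # A"] exI[of _ B] exI[of _ C] exI[of _ z]) simp
  qed
qed (simp add: path_def)

lemma closed_walk_simple_subwalk:
  assumes "walk S v hs v" "hs \<noteq> []"
  obtains A B C z where
    "hs = A @ B @ C" "walk S v A z" "simple_closed_walk z B" "walk S z C v"
proof -
  have "v \<in> arrives S ` set hs"
    using assms by (rule walk_end_arrives)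
  then have "\<not> path S v hs v"
    by (simp add: path_def)
  then show thesis
    using that path_or_simple_closed_subwalk[OF assms(1)] by blast
qed

lemma simple_closed_walk_backtracking:
  assumes "simple_closed_walk v (h # hs)" "flip h \<in> set hs"
  shows "hs = [flip h]"
proof -
  obtain X Y where hs: "hs = X @ flip h # Y"
    using assms(2) by (auto dest: split_list)
  have distinct: "distinct (map (leaves S) (h # X @ flip h # Y))"
    using assms(1) unfolding hs simple_closed_walk_def by blast
  have "walk S (arrives S h) X (arrives S h)" "walk S (leaves S h) Y (leaves S h)"
    using assms(1) hs by (auto simp: simple_closed_walk_def walk_append)
  then have "X = []" "Y = []"
    using distinct by (fastforce dest: walk_start_leaves)+
  then show ?thesis
    using hs by simp
qed

lemma simple_closed_walk_distinct_edges:
  assumes "simple_closed_walk v hs"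
  shows "distinct (map fst hs) \<or> (\<exists>h. hs = [h, flip h])"
proof (rule disjCI, rule ccontr)
  assume not_backtracking: "\<nexists>h. hs = [h, flip h]" and "\<not> distinct (map fst hs)"
  then obtain X h Y k Z where hs: "hs = X @ h # Y @ k # Z" and "fst h = fst k"
    using not_distinct_decomp[of "map fst hs"]
    by (auto simp: map_eq_append_conv append_eq_map_conv Cons_eq_map_conv)
  moreover have "k \<noteq> h"
    using assms hs by (auto simp: simple_closed_walk_def)
  ultimately have k: "k = flip h"
    by (simp add: fst_eq_iff_flip)
  obtain w where "simple_closed_walk w ((h # Y @ k # Z) @ X)"
    using simple_closed_walk_rotate[of v X "h # Y @ k # Z"] assms hs by auto
  then have "Y @ k # Z @ X = [flip h]"
    using simple_closed_walk_backtracking[of w h "Y @ k # Z @ X"] k by simp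
  then show False
    using not_backtracking hs k by (auto simp: append_eq_Cons_conv)
qed

lemma cycle_walk_iff:
  "cycle_walk S hs \<longleftrightarrow> (\<exists>v. simple_closed_walk v hs) \<and> distinct (map fst hs)"
  by (auto simp: cycle_walk_def simple_closed_walk_def closed_walk_iff)

lemma prod_esign_distinct:
  assumes "distinct (map fst hs)" "edges_of hs \<subseteq> edges S"
  shows "(\<Prod>e\<in>edges_of hs. esign S e) = (if negative hs then -1 else 1)"
  using assms prod_list_edges[of "esign S" hs]
  by (auto simp: prod_list_esign count_list_distinct_edges)

lemma cycle_walk_prod_esign:
  assumes "cycle_walk S hs"
  shows "(\<Prod>e\<in>edges_of hs. esign S e) = (if negative hs then -1 else 1)"
  using assms
  by (intro prod_esign_distinct) (auto simp: cycle_walk_iff simple_closed_walk_def dest: walk_edges)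

lemma balanced_cycle_iff: "cycle_walk S hs \<Longrightarrow> balanced_cycle S (edges_of hs) \<longleftrightarrow> \<not> negative hs"
  and unbalanced_cycle_iff: "cycle_walk S hs \<Longrightarrow> unbalanced_cycle S (edges_of hs) \<longleftrightarrow> negative hs"
  using cycle_walk_prod_esign[of hs]
  by (auto simp: balanced_cycle_def unbalanced_cycle_def cycle_def)

lemma unbalanced_cycleE:
  assumes "unbalanced_cycle S C"
  obtains v hs where "simple_closed_walk v hs" "cycle_walk S hs" "negative hs" "C = edges_of hs"
proof -
  obtain hs where "cycle_walk S hs" "C = edges_of hs"
    using assms by (auto simp: unbalanced_cycle_def cycle_def)
  then show thesis
    using that assms unbalanced_cycle_iff cycle_walk_iff by blast
qed

lemma negative_simple_closed_walk:
  assumes "simple_closed_walk v hs" "negative hs"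
  shows "cycle_walk S hs" "unbalanced_cycle S (edges_of hs)"
proof -
  have "distinct (map fst hs)"
    using simple_closed_walk_distinct_edges[OF assms(1)] assms(2) by auto
  then show "cycle_walk S hs"
    using assms(1) by (auto simp: cycle_walk_iff)
  then show "unbalanced_cycle S (edges_of hs)"
    using assms(2) unbalanced_cycle_iff by simp
qed

lemma negative_closed_walk_simple:
  assumes "walk S v hs v" "negative hs"
  obtains P B z where "walk S v P z" "simple_closed_walk z B" "negative B"
  using assms
proof (induction "length hs" arbitrary: hs thesis rule: less_induct)
  case less
  have "hs \<noteq> []"
    using less.prems(3) by auto
  then obtain A B C z where sub: "hs = A @ B @ C" "walk S v A z" "simple_closed_walk z B"
      "walk S z C v"
    using closed_walk_simple_subwalk[OF less.prems(2)] by metis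
  show ?case
  proof (cases "negative B")
    case True
    then show ?thesis
      using less.prems(1) sub by blast
  next
    case False
    moreover have "B \<noteq> []"
      using sub(3) by (simp add: simple_closed_walk_def)
    ultimately have "length (A @ C) < length hs" "walk S v (A @ C) v" "negative (A @ C)"
      using less.prems(3) sub by auto
    then show ?thesis
      using less.hyps less.prems(1) by blast
  qed
qed

section \<open>Circuit walks\<close>

lemma simple_closed_walk_loop:
  assumes "simple_closed_walk v hs" "h \<in> set hs" "leaves S h = arrives S h"
  shows "hs = [h]"
proof -
  obtain X Y where hs: "hs = X @ h # Y"
    using assms(2) by (auto dest: split_list)
  then obtain w where w: "simple_closed_walk w (h # Y @ X)"
    using simple_closed_walk_rotate[of v X "h # Y"] assms(1) by auto
  then have "walk S (leaves S h) (Y @ X) (leaves S h)"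
    using assms(3) by (auto simp: simple_closed_walk_def)
  then have "Y @ X = []"
    using w by (fastforce simp: simple_closed_walk_def dest: walk_start_leaves)
  then show ?thesis
    using hs by simp
qed

lemma cycle_disjoint_edges:
  assumes "cycle S C1" "cycle S C2" "C1 \<noteq> C2" "edge_verts S C1 \<inter> edge_verts S C2 \<subseteq> {v}"
  shows "C1 \<inter> C2 = {}"
proof (rule ccontr)
  assume "C1 \<inter> C2 \<noteq> {}"
  then obtain e where e: "e \<in> C1" "e \<in> C2"
    by auto
  have loop: "leaves S h = v \<and> arrives S h = v" if "fst h = e" for h
    using that e endpoints_in_edge_verts[of h C1 S] endpoints_in_edge_verts[of h C2 S] assms(4)
    by auto
  have "C = {e}" if C: "cycle S C" "e \<in> C" for C
  proof -
    obtain w hs where hs: "simple_closed_walk w hs" "edges_of hs = C"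
      using C(1) by (auto simp: cycle_def cycle_walk_iff)
    then obtain h where "h \<in> set hs" "fst h = e"
      using C(2) by (auto simp: edges_of_def)
    then show ?thesis
      using simple_closed_walk_loop[OF hs(1), of h] loop[of h] hs(2) by auto
  qed
  then show False
    using assms(1-3) e by blast
qed

lemma unbalanced_cycle_prod_esign: "unbalanced_cycle S C \<Longrightarrow> (\<Prod>e\<in>C. esign S e) = -1"
  using cycle_walk_prod_esign by (auto elim!: unbalanced_cycleE)

lemma unbalanced_cycles_prod_esign:
  assumes "unbalanced_cycle S C1" "unbalanced_cycle S C2" "C1 \<inter> C2 = {}"
  shows "(\<Prod>e\<in>C1 \<union> C2. esign S e) = 1"
proof -
  have "finite C1" "finite C2"
    using assms(1,2) finite_edges_of by (auto simp: unbalanced_cycle_def cycle_def)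
  then show ?thesis
    using assms by (simp add: prod.union_disjoint unbalanced_cycle_prod_esign)
qed

lemma circuit_prod_esign:
  assumes "circuit S C P"
  shows "(\<Prod>e\<in>C - P. esign S e) = 1"
  using assms
proof cases
  case balanced
  then show ?thesis
    by (simp add: balanced_cycle_def)
next
  case (tight_handcuff C1 C2 v)
  then have "C1 \<inter> C2 = {}"
    by (intro cycle_disjoint_edges[of _ _ v]) (auto simp: unbalanced_cycle_def)
  then show ?thesis
    using tight_handcuff unbalanced_cycles_prod_esign by simp
next
  case (loose_handcuff C1 C2 u ps w)
  then have "C - P = C1 \<union> C2"
    using path_disjoint_edges[OF loose_handcuff(6,7)] path_disjoint_edges[OF loose_handcuff(6,8)]
    by auto
  moreover have "C1 \<inter> C2 = {}"
    using loose_handcuff by (auto simp: edge_verts_def)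
  ultimately show ?thesis
    using loose_handcuff unbalanced_cycles_prod_esign by simp
qed

lemma circuit_walk_not_negative:
  assumes "circuit_walk S hs"
  shows "\<not> negative hs"
proof -
  obtain C P where C: "circuit S C P" "edges_of hs = C"
    and count: "\<And>e. e \<in> C \<Longrightarrow> count_list (map fst hs) e = (if e \<in> P then 2 else 1)"
    using assms by (auto simp: circuit_walk_def)
  obtain v where "walk S v hs v"
    using assms by (auto simp: circuit_walk_def closed_walk_iff)
  then have C_edges: "C \<subseteq> edges S" "finite C"
    using C(2) finite_edges_of by (auto dest: walk_edges)
  have "(if negative hs then -1 else 1) = (\<Prod>h\<leftarrow>hs. esign S (fst h))"
    using C C_edges by (simp add: prod_list_esign)
  also have "\<dots> = (\<Prod>e\<in>C. esign S e ^ (if e \<in> P then 2 else 1))"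
    using C(2) count by (simp add: prod_list_edges)
  also have "\<dots> = (\<Prod>e\<in>C - P. esign S e)"
  proof (intro prod.mono_neutral_cong_right ballI)
    show "esign S e ^ (if e \<in> P then 2 else 1) = 1" if "e \<in> C - (C - P)" for e
      using that esign_cases[OF subsetD[OF C_edges(1), of e]] by auto
  qed (use C_edges in auto)
  also have "\<dots> = 1"
    using C(1) by (rule circuit_prod_esign)
  finally show ?thesis
    by (simp split: if_splits)
qed

lemma cycle_walk_circuit_walk:
  assumes "cycle_walk S hs" "\<not> negative hs"
  shows "circuit_walk S hs"
proof -
  have "circuit S (edges_of hs) {}"
    using assms by (intro circuit.balanced) (simp add: balanced_cycle_iff)
  then show ?thesis
    using assms(1)
    by (auto simp: circuit_walk_def cycle_walk_def count_list_distinct_edges intro!: exI[of _ "{}"])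
qed

text \<open>The handcuff is tight if \<open>P = []\<close> and loose otherwise.\<close>

definition handcuff ::
    "'v \<Rightarrow> ('e \<times> bool) list \<Rightarrow> ('e \<times> bool) list \<Rightarrow> 'v \<Rightarrow> ('e \<times> bool) list \<Rightarrow> bool"
where
  "handcuff y B P x D \<longleftrightarrow>
     simple_closed_walk y B \<and> negative B \<and> simple_closed_walk x D \<and> negative D \<and> path S y P x \<and>
     visited S y B \<inter> visited S y P = {y} \<and> visited S x D \<inter> visited S y P = {x} \<and>
     visited S y B \<inter> visited S x D \<subseteq> {x, y}"

lemma handcuff_cycle_verts:
  assumes "handcuff y B P x D"
  shows "edge_verts S (edges_of B) = visited S y B" "edge_verts S (edges_of D) = visited S x D"
proof -
  have walks: "walk S y B y" "B \<noteq> []" "walk S x D x" "D \<noteq> []"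
    using assms by (simp_all add: handcuff_def simple_closed_walk_def)
  show "edge_verts S (edges_of B) = visited S y B" "edge_verts S (edges_of D) = visited S x D"
    by (rule edge_verts_walk[OF walks(1,2)], rule edge_verts_walk[OF walks(3,4)])
qed

lemma handcuff_path:
  assumes "handcuff y B P x D"
  shows "path S y P x" "visited S y P \<inter> edge_verts S (edges_of B) = {y}"
    "visited S y P \<inter> edge_verts S (edges_of D) = {x}"
  using assms unfolding handcuff_cycle_verts[OF assms] handcuff_def by blast+

lemma handcuff_unbalanced_cycles:
  assumes "handcuff y B P x D"
  shows "unbalanced_cycle S (edges_of B)" "unbalanced_cycle S (edges_of D)"
  using assms negative_simple_closed_walk(2) by (auto simp: handcuff_def)

lemma handcuff_cycles_meet:
  assumes "handcuff y B P x D"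
  shows "edge_verts S (edges_of B) \<inter> edge_verts S (edges_of D) = (if P = [] then {y} else {})"
proof (cases "P = []")
  case True
  then show ?thesis
    unfolding handcuff_cycle_verts[OF assms] using assms by (auto simp: handcuff_def path_def)
next
  case False
  have "x \<in> arrives S ` set P" "y \<notin> arrives S ` set P"
    using assms False walk_end_arrives[of S y P x] by (auto simp: handcuff_def path_def)
  then have "x \<noteq> y"
    by blast
  then have "visited S y B \<inter> visited S x D = {}"
    using assms unfolding handcuff_def by blast
  then show ?thesis
    unfolding handcuff_cycle_verts[OF assms] using False by simp
qed

lemma handcuff_edges_disjoint:
  assumes "handcuff y B P x D" "edges_of B \<noteq> edges_of D"
  shows "edges_of P \<inter> edges_of B = {}" "edges_of P \<inter> edges_of D = {}"
    "edges_of B \<inter> edges_of D = {}"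
proof -
  note path = handcuff_path[OF assms(1)]
  show "edges_of P \<inter> edges_of B = {}" "edges_of P \<inter> edges_of D = {}"
    using path_disjoint_edges[OF path(1)] path(2,3) by auto
  show "edges_of B \<inter> edges_of D = {}"
    using handcuff_unbalanced_cycles[OF assms(1)] handcuff_cycles_meet[OF assms(1)]
    by (intro cycle_disjoint_edges[OF _ _ assms(2), of y]) (auto simp: unbalanced_cycle_def)
qed

lemma handcuff_circuit:
  assumes "handcuff y B P x D" "edges_of B \<noteq> edges_of D"
  shows "circuit S (edges_of B \<union> edges_of D \<union> edges_of P) (edges_of P)"
proof (cases "P = []")
  case True
  then show ?thesis
    using circuit.tight_handcuff[OF handcuff_unbalanced_cycles[OF assms(1)] assms(2)]
      handcuff_cycles_meet[OF assms(1)] by simp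
next
  case False
  then have "edge_verts S (edges_of B) \<inter> edge_verts S (edges_of D) = {}"
    using handcuff_cycles_meet[OF assms(1)] by simp
  then show ?thesis
    using handcuff_unbalanced_cycles[OF assms(1)] handcuff_path[OF assms(1)]
    by (intro circuit.loose_handcuff)
qed

lemma handcuff_circuit_walk:
  assumes "handcuff y B P x D" "edges_of B \<noteq> edges_of D"
  shows "circuit_walk S (B @ P @ D @ reverse_walk P)"
proof -
  have "distinct (map fst B)" "distinct (map fst D)" "distinct (map fst P)"
    using assms(1) negative_simple_closed_walk(1) path_distinct_edges
    by (auto simp: handcuff_def cycle_walk_def)
  then have "count_list (map fst (B @ P @ D @ reverse_walk P)) e = (if e \<in> edges_of P then 2 else 1)"
    if "e \<in> edges_of B \<union> edges_of D \<union> edges_of P" for e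
    using that handcuff_edges_disjoint[OF assms]
    by (auto simp: count_list_distinct_edges)
  moreover have "closed_walk S (B @ P @ D @ reverse_walk P)"
    using assms(1) unfolding handcuff_def path_def simple_closed_walk_def closed_walk_iff by blast
  ultimately show ?thesis
    using handcuff_circuit[OF assms] by (auto simp: circuit_walk_def Un_ac)
qed

lemma handcuff_same_edges:
  assumes "handcuff y B P x D" "edges_of B = edges_of D"
  obtains h k where "B = [h]" "P = []" "D = [k]" "fst h = fst k"
proof -
  have walks: "walk S y B y" "B \<noteq> []" "distinct (map (leaves S) B)"
      "walk S x D x" "D \<noteq> []" "distinct (map (leaves S) D)"
    using assms(1) by (auto simp: handcuff_def simple_closed_walk_def)
  have "edge_verts S (edges_of B) = {y}" "edge_verts S (edges_of D) = {y}" "P = []"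
    using walks handcuff_cycles_meet[OF assms(1)] handcuff_path(2)[OF assms(1)] assms(2)
    by (auto split: if_splits)
  moreover from this have "leaves S ` set B = {y}" "leaves S ` set D = {y}"
    using edge_verts_walk visited_closed_walk walks by metis+
  then have "length B = 1" "length D = 1"
    using distinct_card[OF walks(3)] distinct_card[OF walks(6)] by simp_all
  ultimately show thesis
    using that assms(2) by (auto simp: length_Suc_conv)
qed

section \<open>Components\<close>

definition reachable :: "('v \<times> 'v) set" where
  "reachable = {(u, v). u \<in> verts S \<and> v \<in> verts S \<and> (\<exists>hs. walk S u hs v)}"

lemma reachable_iff: "(u, v) \<in> reachable \<longleftrightarrow> (\<exists>hs. walk S u hs v)"
  by (auto simp: reachable_def dest: walk_in_verts)

lemma equiv_reachable: "equiv (verts S) reachable"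
proof (rule equivI)
  show "refl_on (verts S) reachable"
    by (auto simp: refl_on_def reachable_iff intro: exI[of _ "[]"])
  show "reachable \<subseteq> verts S \<times> verts S"
    by (auto simp: reachable_def)
  show "sym reachable"
    by (auto simp: sym_def reachable_iff)
  show "trans reachable"
    by (auto simp: trans_def reachable_iff)
qed

lemma components_quotient: "components S = verts S // reachable"
  by (simp add: components_def reachable_def)

definition balanced_at :: "'v \<Rightarrow> bool" where
  "balanced_at v \<longleftrightarrow> (\<nexists>hs. walk S v hs v \<and> negative hs)"

lemma not_balanced_at_iff_unbalanced_cycle:
  "\<not> balanced_at r \<longleftrightarrow> (\<exists>C. unbalanced_cycle S C \<and> edge_verts S C \<subseteq> reachable `` {r})"
proof
  assume "\<not> balanced_at r"
  then obtain hs where "walk S r hs r" "negative hs"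
    by (auto simp: balanced_at_def)
  then obtain P B z where P: "walk S r P z" and B: "simple_closed_walk z B" "negative B"
    by (rule negative_closed_walk_simple)
  then have B_walk: "walk S z B z" "B \<noteq> []"
    by (simp_all add: simple_closed_walk_def)
  have "visited S z B \<subseteq> reachable `` {r}"
  proof
    fix x
    assume "x \<in> visited S z B"
    then obtain A where "walk S z A x"
      using walk_split[OF B_walk(1)] by metis
    then show "x \<in> reachable `` {r}"
      using P by (auto simp: reachable_iff)
  qed
  then show "\<exists>C. unbalanced_cycle S C \<and> edge_verts S C \<subseteq> reachable `` {r}"
    using negative_simple_closed_walk(2)[OF B] edge_verts_walk[OF B_walk] by metis
next
  assume "\<exists>C. unbalanced_cycle S C \<and> edge_verts S C \<subseteq> reachable `` {r}"
  then obtain v hs where hs: "simple_closed_walk v hs" "negative hs"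
      and reach: "edge_verts S (edges_of hs) \<subseteq> reachable `` {r}"
    by (auto elim!: unbalanced_cycleE)
  then have walk: "walk S v hs v" "hs \<noteq> []"
    by (simp_all add: simple_closed_walk_def)
  then obtain P where "walk S r P v"
    using reach edge_verts_walk[OF walk] by (auto simp: reachable_iff)
  then have "walk S r (P @ hs @ reverse_walk P) r" "negative (P @ hs @ reverse_walk P)"
    using walk(1) hs(2) by auto
  then show "\<not> balanced_at r"
    unfolding balanced_at_def by blast
qed

lemma balanced_component_iff:
  assumes "r \<in> verts S"
  shows "balanced_component S (reachable `` {r}) \<longleftrightarrow> balanced_at r"
  using assms not_balanced_at_iff_unbalanced_cycle[of r]
  by (auto simp: balanced_component_def components_quotient balanced_cycle_def unbalanced_cycle_def
      intro: quotientI)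

definition root :: "'v \<Rightarrow> 'v" where
  "root v = (SOME u. (v, u) \<in> reachable)"

definition roots :: "'v set" where
  "roots = root ` verts S"

definition unbalanced_roots :: "'v set" where
  "unbalanced_roots = {r \<in> roots. \<not> balanced_at r}"

lemma root_reachable: "v \<in> verts S \<Longrightarrow> (v, root v) \<in> reachable"
  unfolding root_def by (rule someI[of _ v]) (auto simp: reachable_iff intro: exI[of _ "[]"])

lemma root_cong:
  assumes "(u, v) \<in> reachable"
  shows "root u = root v"
proof -
  have "(u, w) \<in> reachable \<longleftrightarrow> (v, w) \<in> reachable" for w
    using equiv_class_eq[OF equiv_reachable assms] by blast
  then show ?thesis
    by (simp add: root_def)
qed

lemma walk_root_eq: "walk S u hs v \<Longrightarrow> root u = root v"
  by (rule root_cong) (auto simp: reachable_iff)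

lemma roots_subset: "roots \<subseteq> verts S"
  using root_reachable by (auto simp: roots_def reachable_def)

lemma root_of_root: "r \<in> roots \<Longrightarrow> root r = r"
  using root_cong[OF root_reachable] by (auto simp: roots_def)

lemma bij_betw_roots_components: "bij_betw (\<lambda>r. reachable `` {r}) roots (components S)"
proof (rule bij_betw_imageI)
  show "inj_on (\<lambda>r. reachable `` {r}) roots"
  proof (rule inj_onI)
    fix r s
    assume rs: "r \<in> roots" "s \<in> roots" "reachable `` {r} = reachable `` {s}"
    then have "(r, s) \<in> reachable"
      using equiv_reachable roots_subset by (meson eq_equiv_class subsetD)
    then show "r = s"
      using root_cong root_of_root rs by metis
  qed
  have "reachable `` {root v} = reachable `` {v}" if "v \<in> verts S" for v
    using equiv_class_eq[OF equiv_reachable root_reachable[OF that]] by simp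
  then show "(\<lambda>r. reachable `` {r}) ` roots = components S"
    by (auto simp: components_quotient quotient_def roots_def)
qed

lemma card_roots_Collect:
  "card {r \<in> roots. Q (reachable `` {r})} = card {X \<in> components S. Q X}"
proof (rule bij_betw_same_card)
  have "components S = (\<lambda>r. reachable `` {r}) ` roots"
    using bij_betw_imp_surj_on[OF bij_betw_roots_components] by simp
  then have "(\<lambda>r. reachable `` {r}) ` {r \<in> roots. Q (reachable `` {r})} = {X \<in> components S. Q X}"
    by auto
  then show "bij_betw (\<lambda>r. reachable `` {r}) {r \<in> roots. Q (reachable `` {r})}
      {X \<in> components S. Q X}"
    by (intro bij_betw_subset[OF bij_betw_roots_components]) auto
qed

lemma card_roots: "card roots = num_components S"
  using card_roots_Collect[of "\<lambda>_. True"] by (simp add: num_components_def)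

lemma card_unbalanced_roots: "card unbalanced_roots = num_unbalanced S"
proof -
  have "unbalanced_roots = {r \<in> roots. \<not> balanced_component S (reachable `` {r})}"
    using balanced_component_iff roots_subset by (auto simp: unbalanced_roots_def)
  then show ?thesis
    by (simp add: num_unbalanced_def card_roots_Collect[of "\<lambda>X. \<not> balanced_component S X"])
qed

lemma num_components_eq: "num_components S = num_balanced S + num_unbalanced S"
proof -
  have "finite (components S)"
    using bij_betw_finite[OF bij_betw_roots_components] finite_verts by (simp add: roots_def)
  then show ?thesis
    unfolding num_components_def num_balanced_def num_unbalanced_def
    by (subst card_Un_disjoint[symmetric]) (auto intro: arg_cong[of _ _ card])
qed

section \<open>Root walks and parallel transport\<close>

definition root_walk :: "'v \<Rightarrow> ('e \<times> bool) list" where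
  "root_walk v = (if v \<in> roots then [] else SOME hs. walk S (root v) hs v)"

definition negative_loop :: "'v \<Rightarrow> ('e \<times> bool) list" where
  "negative_loop r = (SOME hs. walk S r hs r \<and> negative hs)"

lemma walk_root_walk:
  assumes "v \<in> verts S"
  shows "walk S (root v) (root_walk v) v"
proof -
  have "\<exists>hs. walk S (root v) hs v"
    using root_reachable[OF assms] by (auto simp: reachable_iff)
  then show ?thesis
    using assms by (auto simp: root_walk_def root_of_root intro: someI_ex)
qed

lemma negative_loop:
  assumes "\<not> balanced_at r"
  shows "walk S r (negative_loop r) r" "negative (negative_loop r)"
  using someI_ex[of "\<lambda>hs. walk S r hs r \<and> negative hs"] assms
  by (auto simp: balanced_at_def negative_loop_def)

text \<open>
  A parameter at a vertex that is not a root is the displacement of its root walk; at the root of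
  an unbalanced component it is the displacement of the negative closed walks there.
\<close>

definition parameters :: "'v set" where
  "parameters = (verts S - roots) \<union> unbalanced_roots"

lemma finite_parameters: "finite parameters"
  using finite_verts by (simp add: parameters_def unbalanced_roots_def roots_def)

lemma card_verts_minus_roots: "card (verts S - roots) = card (verts S) - num_components S"
  using roots_subset finite_verts by (simp add: card_Diff_subset card_roots finite_subset)

lemma card_parameters: "card parameters = card (verts S) - num_balanced S"
proof -
  have "num_components S \<le> card (verts S)"
    using card_mono[OF finite_verts roots_subset] by (simp add: card_roots)
  moreover have "card parameters = card (verts S - roots) + card unbalanced_roots"
    unfolding parameters_def
    using finite_verts by (intro card_Un_disjoint) (auto simp: unbalanced_roots_def roots_def)
  ultimately show ?thesis
    by (simp add: card_verts_minus_roots card_unbalanced_roots num_components_eq)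
qed

definition frame :: "('v \<Rightarrow> 'g::ab_group_add) \<Rightarrow> 'v \<Rightarrow> 'g dihedral" where
  "frame q v = Dihedral (if v \<in> roots then 0 else q v) (negative (root_walk v))"

definition monodromy :: "('v \<Rightarrow> 'g::ab_group_add) \<Rightarrow> 'v \<Rightarrow> bool \<Rightarrow> 'g dihedral" where
  "monodromy q r s = (if s then Dihedral (q r) True else 0)"

text \<open>
  The holonomy forced on a walk from \<open>u\<close> to \<open>v\<close>, negative iff \<open>s\<close>: closing it up by the root
  walks, with holonomies \<open>frame q\<close>, gives a closed walk at the root.
\<close>

definition transport :: "('v \<Rightarrow> 'g::ab_group_add) \<Rightarrow> 'v \<Rightarrow> bool \<Rightarrow> 'v \<Rightarrow> 'g dihedral" where
  "transport q u s v =
     - frame q u +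
     (monodromy q (root u) (negative (root_walk u) \<noteq> (s \<noteq> negative (root_walk v))) + frame q v)"

lemma frame_root: "r \<in> roots \<Longrightarrow> frame q r = 0"
  by (intro dihedral.expand) (simp add: frame_def root_walk_def)

lemma reflecting_frame [simp]: "reflecting (frame q v) \<longleftrightarrow> negative (root_walk v)"
  by (simp add: frame_def)

lemma reflecting_monodromy [simp]: "reflecting (monodromy q r s) \<longleftrightarrow> s"
  by (simp add: monodromy_def)

lemma monodromy_add: "monodromy q r s + monodromy q r t = monodromy q r (s \<noteq> t)"
  by (simp add: monodromy_def reflecting_add_self)

lemma reflecting_transport [simp]: "reflecting (transport q u s v) \<longleftrightarrow> s"
  by (auto simp: transport_def)

lemma transport_refl: "transport q v False v = 0"
  by (simp add: transport_def monodromy_def)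

lemma transport_add:
  assumes "root u = root w"
  shows "transport q u s w + transport q w t v = transport q u (s \<noteq> t) v"
proof -
  let ?neg = "\<lambda>v. negative (root_walk v)"
  have "transport q u s w + transport q w t v = - frame q u +
      (monodromy q (root w) (?neg u \<noteq> (s \<noteq> ?neg w)) +
       monodromy q (root w) (?neg w \<noteq> (t \<noteq> ?neg v)) + frame q v)"
    by (simp only: transport_def assms add.assoc add_minus_cancel)
  moreover have "((?neg u \<noteq> (s \<noteq> ?neg w)) \<noteq> (?neg w \<noteq> (t \<noteq> ?neg v))) =
      (?neg u \<noteq> ((s \<noteq> t) \<noteq> ?neg v))"
    by auto
  ultimately show ?thesis
    by (simp only: transport_def assms monodromy_add)
qed

lemma uminus_transport:
  assumes "root u = root v"
  shows "- transport q u s v = transport q v s u"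
  using transport_add[OF assms, of q s s u] by (simp add: transport_refl neg_eq_iff_add_eq_0)

end

section \<open>Holonomy\<close>

locale oriented_signed_graph = finite_signed_graph S
  for S :: "('v, 'e) sgraph" and \<omega> :: "'e \<times> bool \<Rightarrow> int" +
  assumes orientation: "compatible_orientation S \<omega>"
begin

lemma orient_cases: "fst h \<in> edges S \<Longrightarrow> \<omega> h \<in> {-1, 1}"
  using orientation by (cases h) (auto simp: compatible_orientation_def)

lemma orient_flip:
  assumes "fst h \<in> edges S"
  shows "\<omega> (flip h) = - (esign S (fst h) * \<omega> h)"
proof -
  have "\<omega> (fst h, True) \<in> {-1, 1}" "\<omega> (fst h, False) \<in> {-1, 1}"
    "esign S (fst h) = - (\<omega> (fst h, True) * \<omega> (fst h, False))"
    using assms orientation by (auto simp: compatible_orientation_def)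
  then show ?thesis
    by (cases h; cases "snd h") (auto simp: flip_def)
qed

definition holonomy :: "('e \<Rightarrow> 'g::ab_group_add) \<Rightarrow> ('e \<times> bool) list \<Rightarrow> 'g dihedral" where
  "holonomy f hs =
     (\<Sum>h\<leftarrow>hs. Dihedral (sign_act (\<omega> h) (f (fst h))) (esign S (fst h) \<noteq> 1))"

lemma holonomy_simps [simp]:
  "holonomy f [] = 0"
  "holonomy f (hs @ ks) = holonomy f hs + holonomy f ks"
  by (simp_all add: holonomy_def)

lemma holonomy_Cons: "holonomy f (h # hs) = holonomy f [h] + holonomy f hs"
  by (simp add: holonomy_def)

lemma reflecting_holonomy [simp]: "reflecting (holonomy f hs) \<longleftrightarrow> negative hs"
  by (induction hs) (simp_all add: holonomy_def)

lemma displacement_holonomy_single: "displacement (holonomy f [h]) = sign_act (\<omega> h) (f (fst h))"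
  by (simp add: holonomy_def)

lemma holonomy_single_inject:
  assumes "holonomy f [h] = holonomy g [h]"
  shows "f (fst h) = g (fst h)"
  using arg_cong[OF assms, of displacement]
  by (simp add: displacement_holonomy_single sign_act_def split: if_splits)

lemma holonomy_flip:
  assumes "fst h \<in> edges S"
  shows "holonomy f [flip h] = - holonomy f [h]"
  using orient_flip[OF assms] orient_cases[OF assms] esign_cases[OF assms]
  by (intro dihedral.expand) (auto simp: displacement_holonomy_single sign_act_def)

lemma holonomy_reverse:
  "edges_of hs \<subseteq> edges S \<Longrightarrow> holonomy f (reverse_walk hs) = - holonomy f hs"
proof (induction hs)
  case (Cons h hs)
  then show ?case
    by (simp add: holonomy_flip minus_add holonomy_Cons[of f h hs] del: add_uminus_conv_diff)
qed simp

lemma holonomy_walk_reverse: "walk S u hs v \<Longrightarrow> holonomy f (reverse_walk hs) = - holonomy f hs"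
  by (rule holonomy_reverse[OF walk_edges])

lemma displacement_holonomy:
  assumes "edges_of hs \<subseteq> edges S"
  shows "displacement (holonomy f hs) =
    (\<Sum>i<length hs. sign_act (\<omega> (hs ! i) * (\<Prod>j<i. esign S (fst (hs ! j)))) (f (fst (hs ! i))))"
    (is "_ = (\<Sum>i<length hs. ?term hs i)")
  using assms
proof (induction hs rule: rev_induct)
  case (snoc h hs)
  have prefix: "(\<Prod>j<i. esign S (fst ((hs @ [h]) ! j))) = (\<Prod>j<i. esign S (fst (hs ! j)))"
    if "i \<le> length hs" for i
    using that by (intro prod.cong) (auto simp: nth_append)
  have "(\<Prod>j<length hs. esign S (fst (hs ! j))) = (\<Prod>h\<leftarrow>hs. esign S (fst h))"
    by (simp add: prod.list_conv_set_nth atLeast0LessThan)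
  also have "\<dots> = (if negative hs then -1 else 1)"
    using snoc.prems by (simp add: prod_list_esign)
  finally have "?term (hs @ [h]) (length hs) =
      (if negative hs then - displacement (holonomy f [h]) else displacement (holonomy f [h]))"
    using snoc.prems orient_cases[of h]
    by (auto simp: prefix displacement_holonomy_single sign_act_def)
  moreover have "(\<Sum>i<length hs. ?term (hs @ [h]) i) = (\<Sum>i<length hs. ?term hs i)"
    by (intro sum.cong) (simp_all add: prefix nth_append)
  ultimately show ?case
    using snoc by simp
qed simp

lemma holonomy_eq_0_iff: "holonomy f hs = 0 \<longleftrightarrow> \<not> negative hs \<and> displacement (holonomy f hs) = 0"
  by (auto intro: dihedral.expand simp del: reflecting_holonomy simp flip: reflecting_holonomy[of f])

lemma tension_iff_holonomy: "tension S \<omega> f \<longleftrightarrow> (\<forall>hs. circuit_walk S hs \<longrightarrow> holonomy f hs = 0)"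
proof -
  have "edges_of hs \<subseteq> edges S" if "circuit_walk S hs" for hs
    using that by (auto simp: circuit_walk_def closed_walk_iff dest: walk_edges)
  then show ?thesis
    by (simp add: tension_def holonomy_eq_0_iff circuit_walk_not_negative flip: displacement_holonomy
        cong: imp_cong)
qed

section \<open>Tensions are flat\<close>

definition flat :: "('e \<Rightarrow> 'g::ab_group_add) \<Rightarrow> bool" where
  "flat f \<longleftrightarrow> (\<forall>v hs. walk S v hs v \<longrightarrow> \<not> negative hs \<longrightarrow> holonomy f hs = 0)"

definition minimal_violation :: "('e \<Rightarrow> 'g::ab_group_add) \<Rightarrow> 'v \<Rightarrow> ('e \<times> bool) list \<Rightarrow> bool" where
  "minimal_violation f v hs \<longleftrightarrow> walk S v hs v \<and> \<not> negative hs \<and> holonomy f hs \<noteq> 0 \<and>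
     (\<forall>w ks. walk S w ks w \<longrightarrow> \<not> negative ks \<longrightarrow> length ks < length hs \<longrightarrow> holonomy f ks = 0)"

lemma minimal_violation_exists:
  assumes "\<not> flat f"
  obtains v hs where "minimal_violation f v hs"
proof -
  define violation where
    "violation hs \<longleftrightarrow> (\<exists>v. walk S v hs v \<and> \<not> negative hs \<and> holonomy f hs \<noteq> 0)" for hs
  obtain ks where "violation ks"
    using assms by (auto simp: flat_def violation_def)
  then obtain hs where "violation hs" and min: "\<And>ks. violation ks \<Longrightarrow> length hs \<le> length ks"
    using ex_has_least_nat[of violation ks length] by blast
  then obtain v where "walk S v hs v" "\<not> negative hs" "holonomy f hs \<noteq> 0"
    by (auto simp: violation_def)
  then show thesis
    using that[of v hs] min by (force simp: minimal_violation_def violation_def)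
qed

lemma minimal_violation_shorter:
  "minimal_violation f v hs \<Longrightarrow> walk S w ks w \<Longrightarrow> \<not> negative ks \<Longrightarrow> length ks < length hs \<Longrightarrow>
   holonomy f ks = 0"
  by (simp add: minimal_violation_def)

lemma minimal_violation_transfer:
  assumes "minimal_violation f v hs" "walk S w ks w" "length ks \<le> length hs"
    "holonomy f ks = holonomy f hs"
  shows "minimal_violation f w ks"
  using assms reflecting_holonomy[of f ks] reflecting_holonomy[of f hs]
  by (simp add: minimal_violation_def)

lemma minimal_violation_rotate:
  assumes "minimal_violation f u (A @ B)" "walk S v (B @ A) v"
  shows "minimal_violation f v (B @ A)"
proof -
  have "holonomy f (B @ A) = 0 \<longleftrightarrow> holonomy f (A @ B) = 0"
    using add_eq_0_iff[of "holonomy f A" "holonomy f B"]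
      add_eq_0_iff2[of "holonomy f B" "holonomy f A"] by simp
  then show ?thesis
    using assms by (auto simp: minimal_violation_def)
qed

lemma minimal_violation_parallel:
  assumes "minimal_violation f w hs" "walk S u A v" "walk S u B v" "negative A = negative B"
    "length A + length B < length hs"
  shows "holonomy f A = holonomy f B"
proof -
  have "holonomy f (A @ reverse_walk B) = 0"
    using assms by (intro minimal_violation_shorter[OF assms(1), of u]) auto
  then show ?thesis
    using assms(3) by (simp add: holonomy_walk_reverse)
qed

lemma minimal_violation_split:
  assumes "minimal_violation f v (A @ B)" "walk S v A v" "walk S v B v" "A \<noteq> []" "B \<noteq> []"
  shows "negative A" "negative B"
proof -
  have "negative A = negative B"
    using assms(1) by (simp add: minimal_violation_def)
  moreover have "holonomy f A + holonomy f B \<noteq> 0"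
    using assms(1) by (simp add: minimal_violation_def)
  ultimately show "negative A" "negative B"
    using minimal_violation_shorter[OF assms(1), of v A] minimal_violation_shorter[OF assms(1), of v B]
      assms(2-5) by auto
qed

lemma minimal_violation_no_triple_point:
  assumes "minimal_violation f v (A @ B @ C)" "walk S v A v" "walk S v B v" "walk S v C v"
    "A \<noteq> []" "B \<noteq> []" "C \<noteq> []"
  shows False
proof -
  have "negative A" "negative (A @ B)"
    using assms minimal_violation_split[of f v A "B @ C"] minimal_violation_split[of f v "A @ B" C]
    by auto
  moreover have "minimal_violation f v (B @ (C @ A))"
    using minimal_violation_rotate[of f v A "B @ C" v] assms by auto
  then have "negative B"
    using assms minimal_violation_split[of f v B "C @ A"] by auto
  ultimately show False
    by simp
qed

text \<open>
  Opposite arcs have equal sign and holonomy, so the whole walk traverses the negative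
  closed walk \<open>A @ B\<close> twice, up to holonomy.
\<close>

lemma minimal_violation_no_crossing:
  assumes "minimal_violation f u (A @ B @ C @ D)"
    "walk S u A v" "walk S v B u" "walk S u C v" "walk S v D u"
    "A \<noteq> []" "B \<noteq> []" "C \<noteq> []" "D \<noteq> []"
  shows False
proof -
  have neg: "negative (A @ B)" "negative (C @ D)"
    using assms minimal_violation_split[of f u "A @ B" "C @ D"] by auto
  have "minimal_violation f v (B @ C @ D @ A)"
    using minimal_violation_rotate[of f u A "B @ C @ D" v] assms by auto
  then have "negative (B @ C)"
    using assms minimal_violation_split(1)[of f v "B @ C" "D @ A"] by auto
  then have "negative A = negative C" "negative B = negative D"
    using neg by auto
  then have "holonomy f A = holonomy f C" "holonomy f B = holonomy f D"
    using assms by (auto intro!: minimal_violation_parallel[OF assms(1)])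
  then have "holonomy f (A @ B @ C @ D) = holonomy f (A @ B) + holonomy f (A @ B)"
    by (simp add: add.assoc)
  also have "\<dots> = 0"
    using neg(1) by (intro reflecting_add_self) simp
  finally show False
    using assms(1) by (simp add: minimal_violation_def)
qed

lemma minimal_violation_not_simple:
  assumes f: "tension S \<omega> f" and "minimal_violation f v hs"
  shows "\<not> simple_closed_walk v hs"
proof
  assume simple: "simple_closed_walk v hs"
  from assms(2) have hs: "walk S v hs v" "\<not> negative hs" "holonomy f hs \<noteq> 0"
    by (simp_all add: minimal_violation_def)
  from simple_closed_walk_distinct_edges[OF simple]
  consider (cycle) "distinct (map fst hs)" | (backtracking) h where "hs = [h, flip h]"
    by blast
  then show False
  proof cases
    case cycle
    then have "circuit_walk S hs"
      using simple hs(2) by (intro cycle_walk_circuit_walk) (auto simp: cycle_walk_iff)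
    then show False
      using f hs(3) by (simp add: tension_iff_holonomy)
  next
    case (backtracking h)
    then have "holonomy f hs = holonomy f [h] + - holonomy f [h]"
      using hs(1) holonomy_Cons[of f h "[flip h]"] by (simp add: holonomy_flip)
    then show False
      using hs(3) by simp
  qed
qed

lemma minimal_violation_two_cycles:
  assumes "tension S \<omega> f" "minimal_violation f v hs"
  obtains y B P x D Q where "minimal_violation f y (B @ P @ D @ Q)"
    "simple_closed_walk y B" "walk S y P x" "simple_closed_walk x D" "walk S x Q y"
proof -
  have "walk S v hs v" "hs \<noteq> []"
    using assms(2) by (auto simp: minimal_violation_def)
  then obtain X B Y y where hs: "hs = X @ B @ Y" "walk S v X y" "walk S y Y v"
    and B: "simple_closed_walk y B"
    using closed_walk_simple_subwalk by metis
  then have "walk S y (Y @ X) y" "walk S y B y"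
    by (auto simp: simple_closed_walk_def)
  then have min: "minimal_violation f y (B @ Y @ X)"
    using assms(2) hs minimal_violation_rotate[of f v X "B @ Y" y] by auto
  have "Y @ X \<noteq> []"
    using minimal_violation_not_simple[OF assms] hs B by auto
  with \<open>walk S y (Y @ X) y\<close> obtain P D Q x where "Y @ X = P @ D @ Q" "walk S y P x"
    "simple_closed_walk x D" "walk S x Q y"
    using closed_walk_simple_subwalk by metis
  then show thesis
    using that[of y B P D Q x] min B by simp
qed

lemma minimal_violation_dumbbell:
  assumes "tension S \<omega> f" "minimal_violation f v hs"
  obtains y B P x D where "minimal_violation f y (B @ P @ D @ reverse_walk P)"
    "simple_closed_walk y B" "negative B" "walk S y P x" "simple_closed_walk x D" "negative D"
proof -
  obtain y B P x D Q where min: "minimal_violation f y (B @ P @ D @ Q)"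
    and simple: "simple_closed_walk y B" "simple_closed_walk x D"
    and P: "walk S y P x" and Q: "walk S x Q y"
    using minimal_violation_two_cycles[OF assms] by metis
  have B: "walk S y B y" "B \<noteq> []" and D: "walk S x D x" "D \<noteq> []"
    using simple by (simp_all add: simple_closed_walk_def)
  have neg_B: "negative B" "negative (P @ D @ Q)"
    using min minimal_violation_split[of f y B "P @ D @ Q"] P Q B D by auto
  have "minimal_violation f x (D @ Q @ B @ P)"
    using min minimal_violation_rotate[of f y "B @ P" "D @ Q" x] P Q B D by auto
  then have neg_D: "negative D"
    using minimal_violation_split[of f x D "Q @ B @ P"] P Q B D by auto
  then have "holonomy f P = holonomy f (reverse_walk Q)"
    using neg_B P Q B D by (intro minimal_violation_parallel[OF min, of y _ x]) auto
  then have PQ: "holonomy f P = - holonomy f Q"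
    using Q by (simp add: holonomy_walk_reverse)
  show thesis
  proof (cases "length P \<le> length Q")
    case True
    then have "minimal_violation f y (B @ P @ D @ reverse_walk P)"
      using PQ P B D
      by (intro minimal_violation_transfer[OF min]) (auto simp: holonomy_walk_reverse)
    then show thesis
      using that simple P neg_B(1) neg_D by blast
  next
    case False
    then have "minimal_violation f y (B @ reverse_walk Q @ D @ reverse_walk (reverse_walk Q))"
      using PQ Q B D
      by (intro minimal_violation_transfer[OF min]) (auto simp: holonomy_walk_reverse)
    then show thesis
      using that simple Q neg_B(1) neg_D by blast
  qed
qed

lemma minimal_violation_dumbbell_sym:
  assumes "minimal_violation f y (B @ P @ D @ reverse_walk P)"
    "walk S y B y" "walk S y P x" "walk S x D x"
  shows "minimal_violation f x (D @ reverse_walk P @ B @ reverse_walk (reverse_walk P))"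
  using assms minimal_violation_rotate[of f y "B @ P" "D @ reverse_walk P" x] by auto

lemma minimal_violation_dumbbell_path:
  assumes min: "minimal_violation f y (B @ P @ D @ reverse_walk P)"
    and walks: "walk S y B y" "walk S y P x" "walk S x D x" and "D \<noteq> []"
  shows "path S y P x"
proof (rule ccontr)
  assume "\<not> path S y P x"
  then obtain P1 P2 P3 z where P: "P = P1 @ P2 @ P3" "walk S y P1 z" "walk S z P3 x"
    and "simple_closed_walk z P2"
    using path_or_simple_closed_subwalk[OF walks(2)] by blast
  then have P2: "walk S z P2 z" "P2 \<noteq> []"
    by (simp_all add: simple_closed_walk_def)
  let ?loop = "reverse_walk P2 @ reverse_walk P1 @ B @ P1"
  have loops: "walk S z (P3 @ D @ reverse_walk P3) z" "walk S z ?loop z"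
    using walks P P2 by blast+
  then have "walk S z (P2 @ (P3 @ D @ reverse_walk P3) @ ?loop) z"
    using P2 by blast
  then have "minimal_violation f z (P2 @ (P3 @ D @ reverse_walk P3) @ ?loop)"
    using min P(1) minimal_violation_rotate[of f y "B @ P1" "P2 @ P3 @ D @ reverse_walk P" z] by simp
  then show False
    by (rule minimal_violation_no_triple_point) (use loops P2 \<open>D \<noteq> []\<close> in simp_all)
qed

lemma minimal_violation_dumbbell_cycle_meets_path:
  assumes min: "minimal_violation f y (B @ P @ D @ reverse_walk P)"
    and walks: "walk S y B y" "walk S y P x" "walk S x D x" and "D \<noteq> []"
  shows "visited S y B \<inter> visited S y P = {y}"
proof (rule ccontr)
  assume "visited S y B \<inter> visited S y P \<noteq> {y}"
  then obtain z where z: "z \<in> visited S y B" "z \<in> visited S y P" "z \<noteq> y"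
    by auto
  obtain B1 B2 where B: "B = B1 @ B2" "walk S y B1 z" "walk S z B2 y"
    using walk_split[OF walks(1) z(1)] by blast
  obtain P1 P2 where P: "P = P1 @ P2" "walk S y P1 z" "walk S z P2 x"
    using walk_split[OF walks(2) z(2)] by blast
  have nonempty: "B1 \<noteq> []" "B2 \<noteq> []" "P1 \<noteq> []"
    using B P z(3) by auto
  have loops: "walk S z (B2 @ P1) z" "walk S z (P2 @ D @ reverse_walk P2) z"
      "walk S z (reverse_walk P1 @ B1) z"
    using walks B P by blast+
  then have "walk S z ((B2 @ P1) @ (P2 @ D @ reverse_walk P2) @ (reverse_walk P1 @ B1)) z"
    by blast
  then have "minimal_violation f z ((B2 @ P1) @ (P2 @ D @ reverse_walk P2) @ (reverse_walk P1 @ B1))"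
    using min B(1) P(1) minimal_violation_rotate[of f y B1 "B2 @ P @ D @ reverse_walk P" z] by simp
  then show False
    by (rule minimal_violation_no_triple_point) (use loops nonempty \<open>D \<noteq> []\<close> in simp_all)
qed

lemma minimal_violation_dumbbell_cycles_meet:
  assumes min: "minimal_violation f y (B @ P @ D @ reverse_walk P)"
    and walks: "walk S y B y" "walk S y P x" "walk S x D x"
  shows "visited S y B \<inter> visited S x D \<subseteq> {x, y}"
proof (rule ccontr)
  assume "\<not> visited S y B \<inter> visited S x D \<subseteq> {x, y}"
  then obtain z where z: "z \<in> visited S y B" "z \<in> visited S x D" "z \<noteq> x" "z \<noteq> y"
    by auto
  obtain B1 B2 where B: "B = B1 @ B2" "walk S y B1 z" "walk S z B2 y"
    using walk_split[OF walks(1) z(1)] by blast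
  obtain D1 D2 where D: "D = D1 @ D2" "walk S x D1 z" "walk S z D2 x"
    using walk_split[OF walks(3) z(2)] by blast
  have nonempty: "B1 \<noteq> []" "B2 \<noteq> []" "D1 \<noteq> []" "D2 \<noteq> []"
    using B D z by auto
  show False
  proof (rule minimal_violation_no_crossing)
    show "minimal_violation f y (B1 @ B2 @ (P @ D1) @ (D2 @ reverse_walk P))"
      using min B D by simp
  qed (use walks B D nonempty in auto)
qed

lemma minimal_violation_handcuff:
  assumes f: "tension S \<omega> f" and "minimal_violation f v hs"
  obtains y B P x D where
    "handcuff y B P x D" "holonomy f (B @ P @ D @ reverse_walk P) \<noteq> 0"
proof -
  obtain y B P x D where min: "minimal_violation f y (B @ P @ D @ reverse_walk P)"
    and B: "simple_closed_walk y B" "negative B" and P: "walk S y P x"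
    and D: "simple_closed_walk x D" "negative D"
    using minimal_violation_dumbbell[OF assms] by metis
  have B_walk: "walk S y B y" "B \<noteq> []" and D_walk: "walk S x D x" "D \<noteq> []"
    using B D by (simp_all add: simple_closed_walk_def)
  note min_sym = minimal_violation_dumbbell_sym[OF min B_walk(1) P D_walk(1)]
  have "handcuff y B P x D"
    using B D minimal_violation_dumbbell_path[OF min B_walk(1) P D_walk]
      minimal_violation_dumbbell_cycle_meets_path[OF min B_walk(1) P D_walk]
      minimal_violation_dumbbell_cycle_meets_path[OF min_sym D_walk(1) walk_reverse[OF P] B_walk]
      minimal_violation_dumbbell_cycles_meet[OF min B_walk(1) P D_walk(1)]
    unfolding handcuff_def visited_reverse_walk[OF P] by simp
  then show thesis
    using that min by (simp add: minimal_violation_def)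
qed

lemma tension_handcuff_holonomy:
  assumes "tension S \<omega> f" "handcuff y B P x D"
  shows "holonomy f (B @ P @ D @ reverse_walk P) = 0"
proof (cases "edges_of B = edges_of D")
  case True
  then obtain h k where loop: "B = [h]" "P = []" "D = [k]" "k = h \<or> k = flip h"
    using handcuff_same_edges[OF assms(2)] by (metis fst_eq_iff_flip)
  moreover have "negative [h]" "fst h \<in> edges S"
    using assms(2) loop(1) by (auto simp: handcuff_def simple_closed_walk_def)
  ultimately have "holonomy f [k] = holonomy f [h]"
    by (auto simp: holonomy_flip uminus_reflecting)
  then show ?thesis
    using loop \<open>negative [h]\<close> reflecting_add_self[of "holonomy f [h]"]
    by (simp add: holonomy_Cons[of f h "[k]"])
next
  case False
  then show ?thesis
    using assms handcuff_circuit_walk tension_iff_holonomy by blast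
qed

lemma flat_imp_tension:
  assumes "flat f"
  shows "tension S \<omega> f"
  unfolding tension_iff_holonomy
proof (intro allI impI)
  fix hs
  assume hs: "circuit_walk S hs"
  then obtain v where "walk S v hs v"
    by (auto simp: circuit_walk_def closed_walk_iff)
  then show "holonomy f hs = 0"
    using assms circuit_walk_not_negative[OF hs] by (simp add: flat_def)
qed

lemma tension_iff_flat: "tension S \<omega> f \<longleftrightarrow> flat f"
proof
  assume f: "tension S \<omega> f"
  show "flat f"
  proof (rule ccontr)
    assume "\<not> flat f"
    then obtain v hs where "minimal_violation f v hs"
      by (rule minimal_violation_exists)
    then show False
      using minimal_violation_handcuff[OF f] tension_handcuff_holonomy[OF f] by metis
  qed
qed (rule flat_imp_tension)

section \<open>Parametrising tensions\<close>

definition of_parameters :: "('v \<Rightarrow> 'g::ab_group_add) \<Rightarrow> 'e \<Rightarrow> 'g" where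
  "of_parameters q = (\<lambda>e\<in>edges S. let h = (e, True) in
     sign_act (\<omega> h) (displacement (transport q (leaves S h) (negative [h]) (arrives S h))))"

definition to_parameters :: "('e \<Rightarrow> 'g::ab_group_add) \<Rightarrow> 'v \<Rightarrow> 'g" where
  "to_parameters f = (\<lambda>v\<in>parameters.
     displacement (holonomy f (if v \<in> roots then negative_loop v else root_walk v)))"

lemma holonomy_of_parameters_single:
  assumes "fst h \<in> edges S"
  shows "holonomy (of_parameters q) [h] = transport q (leaves S h) (negative [h]) (arrives S h)"
proof -
  define k where "k = (fst h, True)"
  have k: "fst k = fst h" "fst k \<in> edges S"
    using assms by (simp_all add: k_def)
  have "sign_act (\<omega> k) (sign_act (\<omega> k) x) = x" for x :: 'a
    using orient_cases[OF k(2)] by (auto simp: sign_act_def)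
  then have holonomy_k:
    "holonomy (of_parameters q) [k] = transport q (leaves S k) (negative [k]) (arrives S k)"
    using assms
    by (intro dihedral.expand) (simp add: displacement_holonomy_single of_parameters_def k_def Let_def)
  have "root (leaves S k) = root (arrives S k)"
    using k(2) arrives_in_verts by (intro walk_root_eq[of _ "[k]"]) simp
  then have "holonomy (of_parameters q) [flip k] =
      transport q (leaves S (flip k)) (negative [flip k]) (arrives S (flip k))"
    using holonomy_k by (simp add: holonomy_flip[OF k(2)] uminus_transport)
  moreover have "h = k \<or> h = flip k"
    using k(1) by (simp add: fst_eq_iff_flip)
  ultimately show ?thesis
    using holonomy_k by auto
qed

lemma holonomy_of_parameters:
  "walk S u hs v \<Longrightarrow> holonomy (of_parameters q) hs = transport q u (negative hs) v"
proof (induction hs arbitrary: u)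
  case (Cons h hs)
  then have h: "fst h \<in> edges S" "leaves S h = u" and hs: "walk S (arrives S h) hs v"
    by auto
  then have "root u = root (arrives S h)"
    using arrives_in_verts by (intro walk_root_eq[of _ "[h]"]) simp
  then show ?case
    using Cons.IH[OF hs] h holonomy_of_parameters_single[OF h(1), of q]
    by (simp add: holonomy_Cons[of _ h hs] transport_add)
qed (simp add: transport_refl)

lemma of_parameters_tension: "of_parameters q \<in> tensions S \<omega>"
proof -
  have "flat (of_parameters q)"
    by (simp add: flat_def holonomy_of_parameters transport_refl)
  then show ?thesis
    by (simp add: tensions_def tension_iff_flat of_parameters_def)
qed

lemma to_parameters_of_parameters:
  assumes "q \<in> parameters \<rightarrow>\<^sub>E UNIV"
  shows "to_parameters (of_parameters q) = q"
proof (rule extensionalityI)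
  show "to_parameters (of_parameters q) \<in> extensional parameters" "q \<in> extensional parameters"
    using assms by (auto simp: to_parameters_def PiE_iff)
next
  fix v
  assume v: "v \<in> parameters"
  show "to_parameters (of_parameters q) v = q v"
  proof (cases "v \<in> roots")
    case True
    then have "\<not> balanced_at v"
      using v by (simp add: parameters_def unbalanced_roots_def)
    then have "holonomy (of_parameters q) (negative_loop v) = transport q v True v"
      using holonomy_of_parameters[OF negative_loop(1)] negative_loop(2) by auto
    also have "\<dots> = Dihedral (q v) True"
      using True by (simp add: transport_def frame_root monodromy_def root_of_root)
    finally show ?thesis
      using v True by (simp add: to_parameters_def)
  next
    case False
    then have "v \<in> verts S" "root v \<in> roots"
      using v by (auto simp: parameters_def unbalanced_roots_def roots_def)
    then have "holonomy (of_parameters q) (root_walk v) = frame q v"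
      using holonomy_of_parameters[OF walk_root_walk, of v q]
      by (simp add: transport_def frame_root monodromy_def root_walk_def[of "root v"])
    then show ?thesis
      using v False by (simp add: to_parameters_def frame_def)
  qed
qed

lemma frame_to_parameters:
  assumes "v \<in> verts S"
  shows "frame (to_parameters f) v = holonomy f (root_walk v)"
  using assms
  by (intro dihedral.expand) (auto simp: frame_def to_parameters_def parameters_def root_walk_def)

lemma flat_parallel:
  assumes "flat f" "walk S u A v" "walk S u B v" "negative A = negative B"
  shows "holonomy f A = holonomy f B"
proof -
  have "walk S u (A @ reverse_walk B) u"
    using assms(2,3) by blast
  then have "holonomy f (A @ reverse_walk B) = 0"
    using assms(1,4) unfolding flat_def by (metis negative_simps(3,4))
  then show ?thesis
    using assms(3) by (simp add: holonomy_walk_reverse)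
qed

lemma flat_monodromy:
  assumes "flat f" "r \<in> roots" "walk S r hs r"
  shows "holonomy f hs = monodromy (to_parameters f) r (negative hs)"
proof (cases "negative hs")
  case True
  then have "\<not> balanced_at r"
    using assms(3) by (auto simp: balanced_at_def)
  note loop = negative_loop[OF this]
  have "holonomy f hs = holonomy f (negative_loop r)"
    using flat_parallel[OF assms(1,3) loop(1)] loop(2) True by simp
  moreover have "r \<in> parameters"
    using assms(2) \<open>\<not> balanced_at r\<close> by (simp add: parameters_def unbalanced_roots_def)
  ultimately show ?thesis
    using True assms(2) loop(2)
    by (intro dihedral.expand) (simp add: monodromy_def to_parameters_def)
next
  case False
  then show ?thesis
    using assms(1,3) by (simp add: flat_def monodromy_def)
qed

lemma flat_holonomy:
  assumes "flat f" "walk S u hs v"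
  shows "holonomy f hs = transport (to_parameters f) u (negative hs) v"
proof -
  have verts: "u \<in> verts S" "v \<in> verts S" and root: "root u = root v"
    using assms(2) walk_in_verts walk_root_eq by auto
  note walks = walk_root_walk[OF verts(1)] walk_root_walk[OF verts(2)]
  let ?W = "root_walk u @ hs @ reverse_walk (root_walk v)"
  have "walk S (root u) ?W (root u)"
    using walks assms(2) root by (metis walk_appendI walk_reverse)
  then have W: "holonomy f ?W = monodromy (to_parameters f) (root u) (negative ?W)"
    using assms(1) verts(1) by (intro flat_monodromy) (simp_all add: roots_def)
  have "holonomy f hs = - holonomy f (root_walk u) + (holonomy f ?W + holonomy f (root_walk v))"
    using walks(2)
    by (simp add: holonomy_walk_reverse add.assoc diff_conv_add_uminus del: add_uminus_conv_diff)
  also have "\<dots> = transport (to_parameters f) u (negative hs) v"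
    unfolding W transport_def using verts by (simp add: frame_to_parameters)
  finally show ?thesis .
qed

lemma of_parameters_to_parameters:
  assumes "f \<in> tensions S \<omega>"
  shows "of_parameters (to_parameters f) = f"
proof (rule extensionalityI)
  show "of_parameters (to_parameters f) \<in> extensional (edges S)" "f \<in> extensional (edges S)"
    using assms by (auto simp: of_parameters_def tensions_def PiE_iff)
next
  fix e
  assume e: "e \<in> edges S"
  define h where "h = (e, True)"
  have h: "fst h = e" "walk S (leaves S h) [h] (arrives S h)"
    using e arrives_in_verts[of h] by (simp_all add: h_def)
  have "flat f"
    using assms by (simp add: tensions_def tension_iff_flat)
  then have "holonomy (of_parameters (to_parameters f)) [h] = holonomy f [h]"
    using flat_holonomy[OF _ h(2)] holonomy_of_parameters[OF h(2)] by metis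
  then show "of_parameters (to_parameters f) e = f e"
    using holonomy_single_inject h(1) by metis
qed

lemma card_tensions_with_parameters:
  fixes Q :: "('v \<Rightarrow> 'g::ab_group_add) set"
  assumes "Q \<subseteq> parameters \<rightarrow>\<^sub>E UNIV"
  shows "card {f \<in> tensions S \<omega>. to_parameters f \<in> Q} = card Q"
proof (rule bij_betw_same_card)
  have "to_parameters (of_parameters q) = q" if "q \<in> Q" for q
    using that assms to_parameters_of_parameters by blast
  then show "bij_betw to_parameters {f \<in> tensions S \<omega>. to_parameters f \<in> Q} Q"
    using of_parameters_to_parameters of_parameters_tension
    by (intro bij_betw_byWitness[where f' = of_parameters]) auto
qed

lemma card_tensions:
  "card (tensions S \<omega> :: ('e \<Rightarrow> 'g::{ab_group_add, finite}) set) =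
   CARD('g) ^ (card (verts S) - num_balanced S)"
proof -
  have "to_parameters f \<in> parameters \<rightarrow>\<^sub>E UNIV" for f :: "'e \<Rightarrow> 'g"
    by (simp add: to_parameters_def)
  then have "card (tensions S \<omega> :: ('e \<Rightarrow> 'g) set) = card (parameters \<rightarrow>\<^sub>E (UNIV :: 'g set))"
    using card_tensions_with_parameters[of "parameters \<rightarrow>\<^sub>E (UNIV :: 'g set)"] by simp
  then show ?thesis
    by (simp add: card_PiE finite_parameters card_parameters)
qed

section \<open>Potential differences\<close>

lemma displacement_holonomy_minus_sum_in_doubles:
  "displacement (holonomy f hs) - (\<Sum>h\<leftarrow>hs. f (fst h)) \<in> doubles"
proof (induction hs)
  case (Cons h hs)
  let ?d = "displacement (holonomy f hs)"
  have "displacement (holonomy f (h # hs)) - (\<Sum>h\<leftarrow>h # hs. f (fst h)) =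
    (sign_act (\<omega> h) (f (fst h)) - f (fst h)) +
    (((if negative [h] then - ?d else ?d) - ?d) + (?d - (\<Sum>h\<leftarrow>hs. f (fst h))))"
    by (simp add: holonomy_Cons[of f h hs] displacement_holonomy_single algebra_simps)
  moreover have "sign_act (\<omega> h) (f (fst h)) - f (fst h) \<in> doubles"
    "(if negative [h] then - ?d else ?d) - ?d \<in> doubles"
    using uminus_diff_self_in_doubles zero_in_doubles by (auto simp: sign_act_def)
  ultimately show ?case
    using Cons.IH by (simp only: doubles_add)
qed (simp add: zero_in_doubles)

lemma sum_in_doubles_iff:
  "(\<Sum>i<length hs. f (fst (hs ! i))) \<in> doubles \<longleftrightarrow> displacement (holonomy f hs) \<in> doubles"
  using add_in_doubles_iff[OF displacement_holonomy_minus_sum_in_doubles, of f hs "\<Sum>h\<leftarrow>hs. f (fst h)"]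
  by (simp add: sum.list_conv_set_nth atLeast0LessThan)

lemma displacement_holonomy_conjugate_in_doubles_iff:
  assumes "walk S u P v" "negative hs"
  shows "displacement (holonomy f (P @ hs @ reverse_walk P)) \<in> doubles \<longleftrightarrow>
    displacement (holonomy f hs) \<in> doubles"
proof -
  have "holonomy f (P @ hs @ reverse_walk P) = holonomy f P + holonomy f hs - holonomy f P"
    by (simp add: holonomy_walk_reverse[OF assms(1)] add.assoc diff_conv_add_uminus
        del: add_uminus_conv_diff)
  then show ?thesis
    using assms(2) by (simp only: displacement_conjugate_in_doubles_iff reflecting_holonomy)
qed

lemma potential_difference_iff_negative_closed_walks:
  assumes f: "tension S \<omega> f"
  shows "potential_difference S \<omega> f \<longleftrightarrow>
    (\<forall>v hs. walk S v hs v \<longrightarrow> negative hs \<longrightarrow> displacement (holonomy f hs) \<in> doubles)"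
proof (intro iffI allI impI)
  fix v hs
  assume pd: "potential_difference S \<omega> f" and hs: "walk S v hs v" "negative hs"
  obtain P B z where P: "walk S v P z" and B: "simple_closed_walk z B" "negative B"
    using hs by (rule negative_closed_walk_simple)
  have "displacement (holonomy f B) \<in> doubles"
    using pd negative_simple_closed_walk[OF B]
    by (simp add: potential_difference_def flip: sum_in_doubles_iff)
  then have "displacement (holonomy f (P @ B @ reverse_walk P)) \<in> doubles"
    by (simp only: displacement_holonomy_conjugate_in_doubles_iff[OF P B(2)])
  moreover have "holonomy f (P @ B @ reverse_walk P) = holonomy f hs"
    using f hs P B
    by (intro flat_parallel[of f v _ v]) (auto simp: tension_iff_flat simple_closed_walk_def)
  ultimately show "displacement (holonomy f hs) \<in> doubles"
    by (simp only:)
next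
  assume doubles: "\<forall>v hs. walk S v hs v \<longrightarrow> negative hs \<longrightarrow> displacement (holonomy f hs) \<in> doubles"
  have "displacement (holonomy f hs) \<in> doubles"
    if "cycle_walk S hs" "unbalanced_cycle S (edges_of hs)" for hs
    using that doubles unbalanced_cycle_iff by (auto simp: cycle_walk_iff simple_closed_walk_def)
  then show "potential_difference S \<omega> f"
    using f by (auto simp: potential_difference_def sum_in_doubles_iff)
qed

lemma potential_difference_iff_parameters:
  assumes f: "tension S \<omega> f"
  shows "potential_difference S \<omega> f \<longleftrightarrow> (\<forall>r\<in>unbalanced_roots. to_parameters f r \<in> doubles)"
proof -
  have loop: "to_parameters f r = displacement (holonomy f (negative_loop r))"
    "walk S r (negative_loop r) r" "negative (negative_loop r)" if "r \<in> unbalanced_roots" for r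
    using that negative_loop
    by (simp_all add: to_parameters_def parameters_def unbalanced_roots_def)
  have "displacement (holonomy f hs) \<in> doubles"
    if par: "\<forall>r\<in>unbalanced_roots. to_parameters f r \<in> doubles" and hs: "walk S v hs v" "negative hs"
    for v hs
  proof -
    have "v \<in> verts S"
      using walk_in_verts[OF hs(1)] by simp
    note T = walk_root_walk[OF this]
    let ?W = "root_walk v @ hs @ reverse_walk (root_walk v)"
    have W: "walk S (root v) ?W (root v)" "negative ?W"
      using T hs by auto
    then have r: "root v \<in> unbalanced_roots"
      using \<open>v \<in> verts S\<close> unfolding unbalanced_roots_def roots_def balanced_at_def by blast
    then have "holonomy f ?W = holonomy f (negative_loop (root v))"
      using f W loop(2,3)[OF r]
      by (intro flat_parallel[of f "root v" _ "root v"]) (simp_all add: tension_iff_flat)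
    then have "displacement (holonomy f ?W) = to_parameters f (root v)"
      by (simp only: loop(1)[OF r])
    then show ?thesis
      using par r displacement_holonomy_conjugate_in_doubles_iff[OF T hs(2), of f] by metis
  qed
  then show ?thesis
    using loop unfolding potential_difference_iff_negative_closed_walks[OF f] by metis
qed

lemma card_potential_differences:
  "card (potential_differences S \<omega> :: ('e \<Rightarrow> 'g::{ab_group_add, finite}) set) =
   CARD('g) ^ (card (verts S) - num_components S) * card (doubles :: 'g set) ^ num_unbalanced S"
proof -
  define range_at where "range_at = (\<lambda>v. if v \<in> roots then doubles else UNIV :: 'g set)"
  have "to_parameters f \<in> Pi\<^sub>E parameters range_at \<longleftrightarrow> (\<forall>r\<in>unbalanced_roots. to_parameters f r \<in> doubles)"
    for f :: "'e \<Rightarrow> 'g"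
    by (auto simp: PiE_iff range_at_def parameters_def unbalanced_roots_def to_parameters_def)
  then have "potential_difference S \<omega> f \<longleftrightarrow>
      tension S \<omega> f \<and> to_parameters f \<in> Pi\<^sub>E parameters range_at" for f :: "'e \<Rightarrow> 'g"
    using potential_difference_iff_parameters potential_difference_def by metis
  then have "(potential_differences S \<omega> :: ('e \<Rightarrow> 'g) set) =
      {f \<in> tensions S \<omega>. to_parameters f \<in> Pi\<^sub>E parameters range_at}"
    by (auto simp: potential_differences_def tensions_def)
  then have "card (potential_differences S \<omega> :: ('e \<Rightarrow> 'g) set) = card (Pi\<^sub>E parameters range_at)"
    by (simp add: card_tensions_with_parameters PiE_mono)
  also have "\<dots> = (\<Prod>v\<in>parameters. card (range_at v))"
    by (rule card_PiE[OF finite_parameters])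
  also have "\<dots> = (\<Prod>v\<in>verts S - roots. card (range_at v)) * (\<Prod>v\<in>unbalanced_roots. card (range_at v))"
    using finite_parameters unfolding parameters_def
    by (intro prod.union_disjoint) (auto simp: unbalanced_roots_def)
  also have "(\<Prod>v\<in>verts S - roots. card (range_at v)) = CARD('g) ^ (card (verts S) - num_components S)"
    by (simp add: range_at_def card_verts_minus_roots)
  also have "(\<Prod>v\<in>unbalanced_roots. card (range_at v)) = card (doubles :: 'g set) ^ num_unbalanced S"
    by (simp add: range_at_def unbalanced_roots_def flip: card_unbalanced_roots)
  finally show ?thesis .
qed

end

theorem theorem7p7:
  fixes S :: "('v, 'e) sgraph" and \<omega> :: "'e \<times> bool \<Rightarrow> int"
  assumes "signed_graph S" and "compatible_orientation S \<omega>"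
  shows "card (tensions S \<omega> :: ('e \<Rightarrow> 'g::{ab_group_add, finite}) set) =
           CARD('g) ^ (card (verts S) - num_balanced S) \<and>
         card (potential_differences S \<omega> :: ('e \<Rightarrow> 'g) set) =
           CARD('g) ^ (card (verts S) - num_components S) *
           card (doubles :: 'g set) ^ num_unbalanced S"
proof -
  interpret oriented_signed_graph S \<omega>
    using assms by unfold_locales
  show ?thesis
    using card_tensions card_potential_differences by blast
qed

end
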